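(* Let $C$ be a non-zero coalgebra over a field $k$ with dual algebra $C^{*}=\mathrm{Hom}_k(C,k)$. The following statements are equivalent: (a) $C$ is coprime as a right $C$-comodule. (b) $C$ is coprime as a left $C$-comodule. (c) $C$ is endo-coprime as a right $C$-comodule. (d) $C$ is fully coprime as a right $C$-comodule. (e) For every left ideal $I$ of $C^{*}$, either $I\rightharpoonup C=0$ or $I\rightharpoonup C=C$. (f) $C^{*}$ is a prime algebra.
   Context: Write $\Delta(c)=\sum c_{1}\otimes c_{2}$ for the comultiplication. The product on $C^{*}$ is the convolution $(f*g)(c)=\sum f(c_{1})g(c_{2})$. Every right $C$-comodule $M$ with coaction $\varrho^{M}:M\to M\otimes C$ is a left $C^{*}$-module via $f\rightharpoonup m=(I_M\otimes f)\circ\varrho^{M}(m)$; in particular $f\rightharpoonup c=\sum c_{1}f(c_{2})$ on $C$. Symmetrically, left $C$-comodules are right $C^{*}$-modules, with $c\leftharpoonup f=\sum f(c_1)c_2$ on $C$. A submodule (subcomodule) is fully invariant if it is mapped into itself by every endomorphism. A non-zero module $M$ over a ring $A$ is: coprime if for every proper fully invariant submodule $K$ of $M$, $\mathrm{Ann}_A(M/K)=\mathrm{Ann}_A(M)$ (equivalently, for every proper submodule $K$); fully coprime if for every proper fully invariant submodule $K$ of $M$, $M$ is $M/K$-generated (a homomorphic image of a direct sum of copies of $M/K$). A right $C$-comodule is coprime (fully coprime) if it is so as a left $C^{*}$-module; a left $C$-comodule is coprime if it is so as a right $C^{*}$-module. A right $C$-comodule $M$ is endo-coprime if for every proper fully invariant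 subcomodule $K$ of $M$ the only comodule endomorphism $f$ of $M$ with image contained in $K$ is $f=0$. *)

theory Defs
  imports "HOL-Algebra.Ideal_Product" "HOL-Algebra.Module" "HOL-Library.Poly_Mapping" "HOL.Vector_Spaces"
begin

section \<open>Modules over a not necessarily commutative ring\<close>

text \<open>
  Modules are given by the record type of \<^theory>\<open>HOL-Algebra.Module\<close>; the locale of
  the same name is not used because it is restricted to commutative rings. The components
  \<open>mult\<close> and \<open>one\<close>, which the record inherits from rings, play no role and are left undefined
  in the modules constructed below.
\<close>

definition module_homs ::
    "('a, 'r) ring_scheme \<Rightarrow> ('a, 'm, 'x) module_scheme \<Rightarrow> ('a, 'n, 'y) module_scheme \<Rightarrow> ('m \<Rightarrow> 'n) set"
  where "module_homs A M N = {h \<in> carrier M \<rightarrow> carrier N.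
    (\<forall>x\<in>carrier M. \<forall>y\<in>carrier M. h (x \<oplus>\<^bsub>M\<^esub> y) = h x \<oplus>\<^bsub>N\<^esub> h y) \<and>
    (\<forall>a\<in>carrier A. \<forall>x\<in>carrier M. h (a \<odot>\<^bsub>M\<^esub> x) = a \<odot>\<^bsub>N\<^esub> h x)}"

definition fully_invariant_submodule ::
    "'m set \<Rightarrow> ('a, 'r) ring_scheme \<Rightarrow> ('a, 'm, 'x) module_scheme \<Rightarrow> bool"
  where "fully_invariant_submodule K A M \<longleftrightarrow>
    submodule K A M \<and> (\<forall>h\<in>module_homs A M M. h ` K \<subseteq> K)"

definition annihilator ::
    "('a, 'r) ring_scheme \<Rightarrow> ('a, 'm, 'x) module_scheme \<Rightarrow> 'a set"
  where "annihilator A M = {a \<in> carrier A. \<forall>x\<in>carrier M. a \<odot>\<^bsub>M\<^esub> x = \<zero>\<^bsub>M\<^esub>}"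

definition quotient_module ::
    "('a, 'm, 'x) module_scheme \<Rightarrow> 'm set \<Rightarrow> ('a, 'm set) module"
  where "quotient_module M K =
    \<lparr>carrier = a_rcosets\<^bsub>M\<^esub> K, mult = undefined, one = undefined, zero = K, add = set_add M,
     smult = (\<lambda>a X. \<Union>x\<in>X. K +>\<^bsub>M\<^esub> (a \<odot>\<^bsub>M\<^esub> x))\<rparr>"

definition direct_sum_copies ::
    "'i set \<Rightarrow> ('a, 'm, 'x) module_scheme \<Rightarrow> ('a, 'i \<Rightarrow> 'm) module"
  where "direct_sum_copies I N =
    \<lparr>carrier = {u \<in> I \<rightarrow>\<^sub>E carrier N. finite {i\<in>I. u i \<noteq> \<zero>\<^bsub>N\<^esub>}},
     mult = undefined, one = undefined,
     zero = (\<lambda>i\<in>I. \<zero>\<^bsub>N\<^esub>), add = (\<lambda>u v. \<lambda>i\<in>I. u i \<oplus>\<^bsub>N\<^esub> v i),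
     smult = (\<lambda>a u. \<lambda>i\<in>I. a \<odot>\<^bsub>N\<^esub> u i)\<rparr>"

text \<open>
  \<open>M\<close> is \<open>N\<close>-generated if it is a homomorphic image of a direct sum of copies of \<open>N\<close>.
  Index sets have to live in some fixed type. Index sets of maps from \<open>N\<close> to \<open>M\<close> are
  sufficient: a homomorphism on a direct sum of copies of \<open>N\<close> is given by a family of
  homomorphisms from \<open>N\<close> to \<open>M\<close>, and discarding repetitions in that family does not change
  the image.
\<close>

definition generated_by ::
    "('a, 'r) ring_scheme \<Rightarrow> ('a, 'm, 'x) module_scheme \<Rightarrow> ('a, 'n, 'y) module_scheme \<Rightarrow> bool"
  where "generated_by A M N \<longleftrightarrow>
    (\<exists>(I :: ('n \<Rightarrow> 'm) set). \<exists>h\<in>module_homs A (direct_sum_copies I N) M.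
       h ` carrier (direct_sum_copies I N) = carrier M)"

definition coprime_module ::
    "('a, 'r) ring_scheme \<Rightarrow> ('a, 'm, 'x) module_scheme \<Rightarrow> bool"
  where "coprime_module A M \<longleftrightarrow>
    carrier M \<noteq> {\<zero>\<^bsub>M\<^esub>} \<and>
    (\<forall>K. fully_invariant_submodule K A M \<and> K \<noteq> carrier M \<longrightarrow>
       annihilator A (quotient_module M K) = annihilator A M)"

definition fully_coprime_module ::
    "('a, 'r) ring_scheme \<Rightarrow> ('a, 'm, 'x) module_scheme \<Rightarrow> bool"
  where "fully_coprime_module A M \<longleftrightarrow>
    carrier M \<noteq> {\<zero>\<^bsub>M\<^esub>} \<and>
    (\<forall>K. fully_invariant_submodule K A M \<and> K \<noteq> carrier M \<longrightarrow>
       generated_by A M (quotient_module M K))"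

definition left_ideal :: "'a set \<Rightarrow> ('a, 'r) ring_scheme \<Rightarrow> bool"
  where "left_ideal I A \<longleftrightarrow>
    additive_subgroup I A \<and> (\<forall>a\<in>carrier A. \<forall>x\<in>I. a \<otimes>\<^bsub>A\<^esub> x \<in> I)"

text \<open>The additive subgroup \<open>IM\<close> of finite sums of elements \<open>ax\<close> with \<open>a \<in> I\<close> and \<open>x \<in> M\<close>.\<close>

inductive_set ideal_smult :: "('a, 'm, 'x) module_scheme \<Rightarrow> 'a set \<Rightarrow> 'm set"
  for M and I where
  smult: "a \<in> I \<Longrightarrow> x \<in> carrier M \<Longrightarrow> a \<odot>\<^bsub>M\<^esub> x \<in> ideal_smult M I"
| add: "x \<in> ideal_smult M I \<Longrightarrow> y \<in> ideal_smult M I \<Longrightarrow> x \<oplus>\<^bsub>M\<^esub> y \<in> ideal_smult M I"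

text \<open>The library notion of prime ideal presupposes a commutative ring.\<close>

definition prime_ring :: "('a, 'r) ring_scheme \<Rightarrow> bool"
  where "prime_ring A \<longleftrightarrow>
    carrier A \<noteq> {\<zero>\<^bsub>A\<^esub>} \<and>
    (\<forall>I J. ideal I A \<and> ideal J A \<and> I \<cdot>\<^bsub>A\<^esub> J = {\<zero>\<^bsub>A\<^esub>} \<longrightarrow> I = {\<zero>\<^bsub>A\<^esub>} \<or> J = {\<zero>\<^bsub>A\<^esub>})"

text \<open>Right \<open>A\<close>-modules are treated as left modules over the opposite ring.\<close>

definition opposite_ring :: "('a, 'r) ring_scheme \<Rightarrow> ('a, 'r) ring_scheme"
  where "opposite_ring A = A\<lparr>mult := \<lambda>a b. b \<otimes>\<^bsub>A\<^esub> a\<rparr>"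


section \<open>Tensor products of vector spaces\<close>

text \<open>
  The free vector space on the set of all \<open>x :: 'x\<close> is the type \<open>'x \<Rightarrow>\<^sub>0 'k\<close> of finitely
  supported functions.
\<close>

definition free_scale :: "'k::field \<Rightarrow> ('x \<Rightarrow>\<^sub>0 'k) \<Rightarrow> ('x \<Rightarrow>\<^sub>0 'k)"
  where "free_scale a t = Poly_Mapping.map ((*) a) t"

abbreviation free_gen :: "'x \<Rightarrow> ('x \<Rightarrow>\<^sub>0 'k::field)"
  where "free_gen x \<equiv> Poly_Mapping.single x 1"

text \<open>The linear extension of \<open>b :: 'x \<Rightarrow> 'v\<close> to the free vector space on \<open>'x\<close>.\<close>

definition free_extend ::
    "('k::field \<Rightarrow> 'v::ab_group_add \<Rightarrow> 'v) \<Rightarrow> ('x \<Rightarrow> 'v) \<Rightarrow> ('x \<Rightarrow>\<^sub>0 'k) \<Rightarrow> 'v"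
  where "free_extend s b t = (\<Sum>p\<in>Poly_Mapping.keys t. s (Poly_Mapping.lookup t p) (b p))"

text \<open>
  The elements of the free vector space on \<open>'x\<close> that have to vanish to make the map
  \<open>\<lambda>v. free_gen (e v)\<close> linear.
\<close>

definition linearity_relations ::
    "('k::field \<Rightarrow> 'v::ab_group_add \<Rightarrow> 'v) \<Rightarrow> ('v \<Rightarrow> 'x) \<Rightarrow> ('x \<Rightarrow>\<^sub>0 'k) set"
  where "linearity_relations s e =
    {free_gen (e (v + w)) - free_gen (e v) - free_gen (e w) |v w. True} \<union>
    {free_gen (e (s a v)) - free_scale a (free_gen (e v)) |a v. True}"

definition tensor_null ::
    "('k::field \<Rightarrow> 'm::ab_group_add \<Rightarrow> 'm) \<Rightarrow> ('k \<Rightarrow> 'n::ab_group_add \<Rightarrow> 'n) \<Rightarrow>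
     ('m \<times> 'n \<Rightarrow>\<^sub>0 'k) set"
  where "tensor_null sM sN = Modules.module.span free_scale
    ((\<Union>y. linearity_relations sM (\<lambda>x. (x, y))) \<union> (\<Union>x. linearity_relations sN (\<lambda>y. (x, y))))"

definition tensor3_null ::
    "('k::field \<Rightarrow> 'm::ab_group_add \<Rightarrow> 'm) \<Rightarrow> ('k \<Rightarrow> 'n::ab_group_add \<Rightarrow> 'n) \<Rightarrow>
     ('k \<Rightarrow> 'p::ab_group_add \<Rightarrow> 'p) \<Rightarrow> ('m \<times> 'n \<times> 'p \<Rightarrow>\<^sub>0 'k) set"
  where "tensor3_null sM sN sP = Modules.module.span free_scale
    ((\<Union>y z. linearity_relations sM (\<lambda>x. (x, y, z))) \<union>
     (\<Union>x z. linearity_relations sN (\<lambda>y. (x, y, z))) \<union>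
     (\<Union>x y. linearity_relations sP (\<lambda>z. (x, y, z))))"

text \<open>
  An element of \<open>M \<otimes> N\<close> is a coset of \<open>tensor_null\<close> in the free vector space on \<open>M \<times> N\<close>.
  Since the scalar multiplications are not determined by the types of \<open>M\<close> and \<open>N\<close>, it is the
  set \<open>tensor_space\<close>, and not a type, that represents \<open>M \<otimes> N\<close>.
\<close>

type_synonym ('k, 'm, 'n) tensor = "('m \<times> 'n \<Rightarrow>\<^sub>0 'k) set"

definition tensor_class ::
    "('k::field \<Rightarrow> 'm::ab_group_add \<Rightarrow> 'm) \<Rightarrow> ('k \<Rightarrow> 'n::ab_group_add \<Rightarrow> 'n) \<Rightarrow>
     ('m \<times> 'n \<Rightarrow>\<^sub>0 'k) \<Rightarrow> ('k, 'm, 'n) tensor"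
  where "tensor_class sM sN t = {u. u - t \<in> tensor_null sM sN}"

definition tensor3_class ::
    "('k::field \<Rightarrow> 'm::ab_group_add \<Rightarrow> 'm) \<Rightarrow> ('k \<Rightarrow> 'n::ab_group_add \<Rightarrow> 'n) \<Rightarrow>
     ('k \<Rightarrow> 'p::ab_group_add \<Rightarrow> 'p) \<Rightarrow> ('m \<times> 'n \<times> 'p \<Rightarrow>\<^sub>0 'k) \<Rightarrow> ('m \<times> 'n \<times> 'p \<Rightarrow>\<^sub>0 'k) set"
  where "tensor3_class sM sN sP t = {u. u - t \<in> tensor3_null sM sN sP}"

definition tensor_space ::
    "('k::field \<Rightarrow> 'm::ab_group_add \<Rightarrow> 'm) \<Rightarrow> ('k \<Rightarrow> 'n::ab_group_add \<Rightarrow> 'n) \<Rightarrow>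
     ('k, 'm, 'n) tensor set"
  where "tensor_space sM sN = range (tensor_class sM sN)"

definition tensor_rep :: "('k::field, 'm, 'n) tensor \<Rightarrow> ('m \<times> 'n \<Rightarrow>\<^sub>0 'k)"
  where "tensor_rep T = (SOME t. t \<in> T)"

text \<open>
  The map \<open>M \<otimes> N \<rightarrow> P\<close> induced by a bilinear map \<open>b\<close>; it does not depend on the chosen
  representative, see \<open>free_extend_tensor_eq\<close> below.
\<close>

definition tensor_lift ::
    "('k::field \<Rightarrow> 'p::ab_group_add \<Rightarrow> 'p) \<Rightarrow> ('m \<Rightarrow> 'n \<Rightarrow> 'p) \<Rightarrow> ('k, 'm, 'n) tensor \<Rightarrow> 'p"
  where "tensor_lift sP b T = free_extend sP (\<lambda>(x, y). b x y) (tensor_rep T)"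

text \<open>\<open>f \<otimes> g : M \<otimes> N \<rightarrow> M' \<otimes> N'\<close>, where \<open>sM\<close> and \<open>sN\<close> belong to \<open>M'\<close> and \<open>N'\<close>.\<close>

definition tensor_map ::
    "('k::field \<Rightarrow> 'm2::ab_group_add \<Rightarrow> 'm2) \<Rightarrow> ('k \<Rightarrow> 'n2::ab_group_add \<Rightarrow> 'n2) \<Rightarrow>
     ('m \<Rightarrow> 'm2) \<Rightarrow> ('n \<Rightarrow> 'n2) \<Rightarrow> ('k, 'm, 'n) tensor \<Rightarrow> ('k, 'm2, 'n2) tensor"
  where "tensor_map sM sN f g T =
    tensor_class sM sN (free_extend free_scale (\<lambda>(x, y). free_gen (f x, g y)) (tensor_rep T))"

text \<open>
  \<open>d \<otimes> I : M \<otimes> N \<rightarrow> L \<otimes> P \<otimes> N\<close> for a linear map \<open>d : M \<rightarrow> L \<otimes> P\<close>, and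
  \<open>I \<otimes> d : M \<otimes> N \<rightarrow> M \<otimes> L \<otimes> P\<close> for a linear map \<open>d : N \<rightarrow> L \<otimes> P\<close>. The threefold tensor
  product represents both bracketings.
\<close>

definition tensor_expand_left ::
    "('k::field \<Rightarrow> 'l::ab_group_add \<Rightarrow> 'l) \<Rightarrow> ('k \<Rightarrow> 'p::ab_group_add \<Rightarrow> 'p) \<Rightarrow>
     ('k \<Rightarrow> 'n::ab_group_add \<Rightarrow> 'n) \<Rightarrow> ('m \<Rightarrow> ('k, 'l, 'p) tensor) \<Rightarrow>
     ('k, 'm, 'n) tensor \<Rightarrow> ('l \<times> 'p \<times> 'n \<Rightarrow>\<^sub>0 'k) set"
  where "tensor_expand_left sL sP sN d T = tensor3_class sL sP sN
    (free_extend free_scale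
       (\<lambda>(x, z). free_extend free_scale (\<lambda>(u, v). free_gen (u, v, z)) (tensor_rep (d x)))
       (tensor_rep T))"

definition tensor_expand_right ::
    "('k::field \<Rightarrow> 'm::ab_group_add \<Rightarrow> 'm) \<Rightarrow> ('k \<Rightarrow> 'l::ab_group_add \<Rightarrow> 'l) \<Rightarrow>
     ('k \<Rightarrow> 'p::ab_group_add \<Rightarrow> 'p) \<Rightarrow> ('n \<Rightarrow> ('k, 'l, 'p) tensor) \<Rightarrow>
     ('k, 'm, 'n) tensor \<Rightarrow> ('m \<times> 'l \<times> 'p \<Rightarrow>\<^sub>0 'k) set"
  where "tensor_expand_right sM sL sP d T = tensor3_class sM sL sP
    (free_extend free_scale
       (\<lambda>(x, z). free_extend free_scale (\<lambda>(u, v). free_gen (x, u, v)) (tensor_rep (d z)))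
       (tensor_rep T))"

text \<open>Linear maps \<open>d : V \<rightarrow> M \<otimes> N\<close>, with the operations on cosets written on elements.\<close>

definition tensor_linear ::
    "('k::field \<Rightarrow> 'm::ab_group_add \<Rightarrow> 'm) \<Rightarrow> ('k \<Rightarrow> 'n::ab_group_add \<Rightarrow> 'n) \<Rightarrow>
     ('k \<Rightarrow> 'v::ab_group_add \<Rightarrow> 'v) \<Rightarrow> ('v \<Rightarrow> ('k, 'm, 'n) tensor) \<Rightarrow> bool"
  where "tensor_linear sM sN sV d \<longleftrightarrow>
    (\<forall>v. d v \<in> tensor_space sM sN) \<and>
    (\<forall>v w. \<forall>t\<in>d v. \<forall>u\<in>d w. t + u \<in> d (v + w)) \<and>
    (\<forall>a v. \<forall>t\<in>d v. free_scale a t \<in> d (sV a v))"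


section \<open>Coalgebras and comodules\<close>

locale coalgebra = vector_space scale
  for scale :: "'k::field \<Rightarrow> 'c::ab_group_add \<Rightarrow> 'c" +
  fixes comult :: "'c \<Rightarrow> ('k, 'c, 'c) tensor"
    and counit :: "'c \<Rightarrow> 'k"
  assumes comult_linear: "tensor_linear scale scale scale comult"
    and counit_linear: "Vector_Spaces.linear scale (*) counit"
    and coassoc: "tensor_expand_left scale scale scale comult (comult c) =
                  tensor_expand_right scale scale scale comult (comult c)"
    and counit_left: "tensor_lift scale (\<lambda>x y. scale (counit x) y) (comult c) = c"
    and counit_right: "tensor_lift scale (\<lambda>x y. scale (counit y) x) (comult c) = c"

locale right_comodule = C: coalgebra sC comult counit + M: vector_space sM
  for sC :: "'k::field \<Rightarrow> 'c::ab_group_add \<Rightarrow> 'c"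
    and comult :: "'c \<Rightarrow> ('k, 'c, 'c) tensor"
    and counit :: "'c \<Rightarrow> 'k"
    and sM :: "'k \<Rightarrow> 'm::ab_group_add \<Rightarrow> 'm" +
  fixes coact :: "'m \<Rightarrow> ('k, 'm, 'c) tensor"
  assumes coact_linear: "tensor_linear sM sC sM coact"
    and coact_coassoc: "tensor_expand_left sM sC sC coact (coact m) =
                        tensor_expand_right sM sC sC comult (coact m)"
    and coact_counit: "tensor_lift sM (\<lambda>x c. sM (counit c) x) (coact m) = m"

locale left_comodule = C: coalgebra sC comult counit + M: vector_space sM
  for sC :: "'k::field \<Rightarrow> 'c::ab_group_add \<Rightarrow> 'c"
    and comult :: "'c \<Rightarrow> ('k, 'c, 'c) tensor"
    and counit :: "'c \<Rightarrow> 'k"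
    and sM :: "'k \<Rightarrow> 'm::ab_group_add \<Rightarrow> 'm" +
  fixes coact :: "'m \<Rightarrow> ('k, 'c, 'm) tensor"
  assumes coact_linear: "tensor_linear sC sM sM coact"
    and coact_coassoc: "tensor_expand_right sC sC sM coact (coact m) =
                        tensor_expand_left sC sC sM comult (coact m)"
    and coact_counit: "tensor_lift sM (\<lambda>c x. sM (counit c) x) (coact m) = m"

definition dual_algebra ::
    "('k::field \<Rightarrow> 'c::ab_group_add \<Rightarrow> 'c) \<Rightarrow> ('c \<Rightarrow> ('k, 'c, 'c) tensor) \<Rightarrow> ('c \<Rightarrow> 'k) \<Rightarrow>
     ('c \<Rightarrow> 'k) ring"
  where "dual_algebra sC comult counit =
    \<lparr>carrier = {f. Vector_Spaces.linear sC (*) f},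
     mult = (\<lambda>f g c. tensor_lift (*) (\<lambda>x y. f x * g y) (comult c)),
     one = counit,
     zero = (\<lambda>c. 0),
     add = (\<lambda>f g c. f c + g c)\<rparr>"

text \<open>The left \<open>C\<^sup>*\<close>-module of a right comodule, \<open>f \<rightharpoonup> m = (I \<otimes> f) (coact m)\<close>.\<close>

definition right_comodule_module ::
    "('k::field \<Rightarrow> 'm::ab_group_add \<Rightarrow> 'm) \<Rightarrow> ('m \<Rightarrow> ('k, 'm, 'c) tensor) \<Rightarrow> ('c \<Rightarrow> 'k, 'm) module"
  where "right_comodule_module sM coact =
    \<lparr>carrier = UNIV, mult = undefined, one = undefined, zero = 0, add = (+),
     smult = (\<lambda>f m. tensor_lift sM (\<lambda>x c. sM (f c) x) (coact m))\<rparr>"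

text \<open>
  The right \<open>C\<^sup>*\<close>-module of a left comodule, \<open>m \<leftharpoonup> f = (f \<otimes> I) (coact m)\<close>; the scalar
  nevertheless is the first argument of \<open>smult\<close>.
\<close>

definition left_comodule_module ::
    "('k::field \<Rightarrow> 'm::ab_group_add \<Rightarrow> 'm) \<Rightarrow> ('m \<Rightarrow> ('k, 'c, 'm) tensor) \<Rightarrow> ('c \<Rightarrow> 'k, 'm) module"
  where "left_comodule_module sM coact =
    \<lparr>carrier = UNIV, mult = undefined, one = undefined, zero = 0, add = (+),
     smult = (\<lambda>f m. tensor_lift sM (\<lambda>c x. sM (f c) x) (coact m))\<rparr>"

definition coprime_right_comodule ::
    "('k::field \<Rightarrow> 'c::ab_group_add \<Rightarrow> 'c) \<Rightarrow> ('c \<Rightarrow> ('k, 'c, 'c) tensor) \<Rightarrow> ('c \<Rightarrow> 'k) \<Rightarrow>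
     ('k \<Rightarrow> 'm::ab_group_add \<Rightarrow> 'm) \<Rightarrow> ('m \<Rightarrow> ('k, 'm, 'c) tensor) \<Rightarrow> bool"
  where "coprime_right_comodule sC comult counit sM coact \<longleftrightarrow>
    coprime_module (dual_algebra sC comult counit) (right_comodule_module sM coact)"

definition coprime_left_comodule ::
    "('k::field \<Rightarrow> 'c::ab_group_add \<Rightarrow> 'c) \<Rightarrow> ('c \<Rightarrow> ('k, 'c, 'c) tensor) \<Rightarrow> ('c \<Rightarrow> 'k) \<Rightarrow>
     ('k \<Rightarrow> 'm::ab_group_add \<Rightarrow> 'm) \<Rightarrow> ('m \<Rightarrow> ('k, 'c, 'm) tensor) \<Rightarrow> bool"
  where "coprime_left_comodule sC comult counit sM coact \<longleftrightarrow>
    coprime_module (opposite_ring (dual_algebra sC comult counit)) (left_comodule_module sM coact)"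

definition fully_coprime_right_comodule ::
    "('k::field \<Rightarrow> 'c::ab_group_add \<Rightarrow> 'c) \<Rightarrow> ('c \<Rightarrow> ('k, 'c, 'c) tensor) \<Rightarrow> ('c \<Rightarrow> 'k) \<Rightarrow>
     ('k \<Rightarrow> 'm::ab_group_add \<Rightarrow> 'm) \<Rightarrow> ('m \<Rightarrow> ('k, 'm, 'c) tensor) \<Rightarrow> bool"
  where "fully_coprime_right_comodule sC comult counit sM coact \<longleftrightarrow>
    fully_coprime_module (dual_algebra sC comult counit) (right_comodule_module sM coact)"

text \<open>
  Over a field, \<open>K \<otimes> C \<rightarrow> M \<otimes> C\<close> is injective, so a subspace \<open>K\<close> is a subcomodule iff
  \<open>coact\<close> maps it into the image of \<open>K \<otimes> C\<close>.
\<close>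

definition right_subcomodule ::
    "'m set \<Rightarrow> ('k::field \<Rightarrow> 'm::ab_group_add \<Rightarrow> 'm) \<Rightarrow> ('m \<Rightarrow> ('k, 'm, 'c) tensor) \<Rightarrow> bool"
  where "right_subcomodule K sM coact \<longleftrightarrow>
    Modules.module.subspace sM K \<and>
    (\<forall>m\<in>K. \<exists>t\<in>coact m. \<forall>p\<in>Poly_Mapping.keys t. fst p \<in> K)"

definition right_comodule_endos ::
    "('k::field \<Rightarrow> 'c::ab_group_add \<Rightarrow> 'c) \<Rightarrow> ('k \<Rightarrow> 'm::ab_group_add \<Rightarrow> 'm) \<Rightarrow>
     ('m \<Rightarrow> ('k, 'm, 'c) tensor) \<Rightarrow> ('m \<Rightarrow> 'm) set"
  where "right_comodule_endos sC sM coact =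
    {f. Vector_Spaces.linear sM sM f \<and>
        (\<forall>m. coact (f m) = tensor_map sM sC f (\<lambda>c. c) (coact m))}"

definition endo_coprime_right_comodule ::
    "('k::field \<Rightarrow> 'c::ab_group_add \<Rightarrow> 'c) \<Rightarrow> ('k \<Rightarrow> 'm::ab_group_add \<Rightarrow> 'm) \<Rightarrow>
     ('m \<Rightarrow> ('k, 'm, 'c) tensor) \<Rightarrow> bool"
  where "endo_coprime_right_comodule sC sM coact \<longleftrightarrow>
    (\<forall>K. right_subcomodule K sM coact \<and> K \<noteq> UNIV \<and>
         (\<forall>h\<in>right_comodule_endos sC sM coact. h ` K \<subseteq> K) \<longrightarrow>
       (\<forall>f\<in>right_comodule_endos sC sM coact. range f \<subseteq> K \<longrightarrow> f = (\<lambda>m. 0)))"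


section \<open>Well-definedness\<close>

lemma lookup_free_scale [simp]:
  "Poly_Mapping.lookup (free_scale a t) p = a * Poly_Mapping.lookup t p"
  by (simp add: free_scale_def Poly_Mapping.map.rep_eq when_def)

lemma vector_space_free_scale: "vector_space (free_scale :: 'k::field \<Rightarrow> ('x \<Rightarrow>\<^sub>0 'k) \<Rightarrow> _)"
  by unfold_locales
    (auto intro!: poly_mapping_eqI simp: Poly_Mapping.lookup_add algebra_simps)

lemma (in vector_space) free_extend_superset:
  assumes "finite S" "Poly_Mapping.keys t \<subseteq> S"
  shows "free_extend scale b t = (\<Sum>p\<in>S. scale (Poly_Mapping.lookup t p) (b p))"
  unfolding free_extend_def
  by (rule sum.mono_neutral_left) (use assms in \<open>auto simp: in_keys_iff\<close>)

lemma (in vector_space) linear_free_extend: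
  fixes b :: "'x \<Rightarrow> 'b"
  shows "Vector_Spaces.linear free_scale scale (free_extend scale b)"
proof -
  interpret F: vector_space "free_scale :: 'a \<Rightarrow> ('x \<Rightarrow>\<^sub>0 'a) \<Rightarrow> _"
    by (rule vector_space_free_scale)
  show ?thesis
  proof
    fix t u :: "'x \<Rightarrow>\<^sub>0 'a"
    let ?S = "Poly_Mapping.keys t \<union> Poly_Mapping.keys u"
    show "free_extend scale b (t + u) = free_extend scale b t + free_extend scale b u"
      using free_extend_superset[of ?S t b] free_extend_superset[of ?S u b]
        free_extend_superset[of ?S "t + u" b] Poly_Mapping.keys_add[of t u]
      by (simp add: Poly_Mapping.lookup_add scale_left_distrib sum.distrib)
  next
    fix a and t :: "'x \<Rightarrow>\<^sub>0 'a"
    have k: "Poly_Mapping.keys (free_scale a t) \<subseteq> Poly_Mapping.keys t"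
      by (auto simp: in_keys_iff)
    show "free_extend scale b (free_scale a t) = scale a (free_extend scale b t)"
      using free_extend_superset[OF _ k, of b] free_extend_superset[of "Poly_Mapping.keys t" t b]
      by (simp add: scale_sum_right)
  qed
qed

lemma free_extend_tensor_eq:
  fixes sP :: "'k::field \<Rightarrow> 'p::ab_group_add \<Rightarrow> 'p"
  assumes "vector_space sP"
    and left: "\<And>y. Vector_Spaces.linear sM sP (\<lambda>x. b x y)"
    and right: "\<And>x. Vector_Spaces.linear sN sP (\<lambda>y. b x y)"
    and "t - u \<in> tensor_null sM sN"
  shows "free_extend sP (\<lambda>(x, y). b x y) t = free_extend sP (\<lambda>(x, y). b x y) u"
proof -
  interpret P: vector_space sP by fact
  let ?E = "free_extend sP (\<lambda>(x, y). b x y)"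
  interpret F: vector_space "free_scale :: 'k \<Rightarrow> ('m \<times> 'n \<Rightarrow>\<^sub>0 'k) \<Rightarrow> _"
    by (rule vector_space_free_scale)
  interpret E: Vector_Spaces.linear free_scale sP ?E
    by (rule P.linear_free_extend)
  have gen: "?E (free_gen (x, y)) = b x y" for x y
    by (simp add: free_extend_def)
  have left_simps: "b (v + w) y = b v y + b w y" "b (sM a v) y = sP a (b v y)" for a v w y
    using left[of y] unfolding linear_iff_module_hom
    by (auto dest: module_hom.add module_hom.scale)
  have right_simps: "b x (v + w) = b x v + b x w" "b x (sN a v) = sP a (b x v)" for a v w x
    using right[of x] unfolding linear_iff_module_hom
    by (auto dest: module_hom.add module_hom.scale)
  have "?E z = 0" if "z \<in> tensor_null sM sN" for z
    using that unfolding tensor_null_def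
  proof (induction z rule: F.span_induct)
    case base
    show ?case
      by (auto simp: F.subspace_def E.add E.scale)
  next
    case (step z)
    then show ?case
      by (auto simp: linearity_relations_def E.diff E.scale gen left_simps right_simps)
  qed
  from this[OF assms(4)] show ?thesis
    by (simp add: E.diff)
qed

context coalgebra
begin

lemma right_comodule_self: "right_comodule scale comult counit scale comult"
  by unfold_locales (fact comult_linear coassoc counit_right)+

lemma left_comodule_self: "left_comodule scale comult counit scale comult"
  by unfold_locales (fact comult_linear coassoc[symmetric] counit_left)+

end

end

theory Submission
  imports Defs
begin

text \<open>
  Write \<open>f \<rightharpoonup> c\<close> and \<open>c \<leftharpoonup> f\<close> for the two actions of the dual algebra on \<open>C\<close>. They are tied
  to the product by \<open>(f * g) c = f (g \<rightharpoonup> c) = g (c \<leftharpoonup> f)\<close>. Since functionals separate the points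
  of \<open>C\<close>, everything about the two actions follows from these equations and the ring laws of the
  dual algebra. The locale \<open>dual_actions\<close> records exactly this, and it is symmetric: the opposite
  algebra exchanges the two actions. Almost the whole proof takes place in it.

  The endomorphisms of the left module \<open>C\<close> are the maps \<open>c \<mapsto> c \<leftharpoonup> u\<close>
  (\<open>module_homs_self\<close>). So the fully invariant submodules are the subspaces closed under both
  actions, and they are the same on either side. Since \<open>C\<close> is a faithful module, coprimeness
  as a right comodule means: if \<open>K\<close> is such a proper subspace and \<open>f \<rightharpoonup> C \<subseteq> K\<close>, then
  \<open>f = 0\<close>. All the other conditions are compared with this one.

  It is equivalent to primeness of the dual algebra, in the form that \<open>f * h * g = 0\<close> for all \<open>h\<close>
  only if \<open>f = 0\<close> or \<open>g = 0\<close> (\<open>lact_coprime_iff_prime\<close>, \<open>prime_ring_iff\<close>). Namely, if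
  \<open>g \<rightharpoonup> C \<subseteq> K\<close> and \<open>f \<noteq> 0\<close> vanishes on \<open>K\<close>, then \<open>f * h * g = 0\<close> for all \<open>h\<close>; conversely,
  given such \<open>f\<close> and \<open>g\<close>, the \<open>c\<close> with \<open>f (h \<rightharpoonup> c \<leftharpoonup> h') = 0\<close> for all \<open>h\<close> and \<open>h'\<close>
  form a subspace \<open>K\<close> that is closed under both actions, contains \<open>g \<rightharpoonup> C\<close>, and is proper
  unless \<open>f = 0\<close>. As primeness does not distinguish an
  algebra from its opposite, the same holds with \<open>C \<leftharpoonup> f\<close> in place of \<open>f \<rightharpoonup> C\<close>, which is
  coprimeness as a left comodule. Endo-coprimeness is literally that condition, because the
  comodule endomorphisms are the maps \<open>c \<mapsto> c \<leftharpoonup> u\<close> too (\<open>right_comodule_endos_eq\<close>).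

  For left ideals one uses that \<open>I \<rightharpoonup> C\<close> is closed under both actions
  (\<open>lact_coprime_iff_left_ideals\<close>). Full coprimeness implies coprimeness by comparing
  annihilators. Conversely, for \<open>u\<close> vanishing on \<open>K\<close> the map \<open>c \<mapsto> c \<leftharpoonup> u\<close> factors through
  \<open>C / K\<close>, and if \<open>C\<close> is coprime, the images of these maps span \<open>C\<close>
  (\<open>fully_coprime_action_module_iff\<close>).

  Tensors enter only to show that a coalgebra is an instance of the locale and to identify
  subcomodules and comodule endomorphisms with their module counterparts. The latter rests on
  the expansion of a tensor along a basis of one factor (\<open>tensor_expansion\<close>).
\<close>


section \<open>Prime rings in terms of elements\<close>

text \<open>
  If \<open>a R b = 0\<close>, then taking annihilators twice turns \<open>b\<close> and \<open>a\<close> into two-sided ideals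
  with product zero: \<open>J\<close> consists of the \<open>y\<close> with \<open>a R y = 0\<close>, and \<open>I\<close> of the \<open>z\<close> with
  \<open>z R J = 0\<close>. This avoids working with the ideals generated by \<open>a\<close> and \<open>b\<close>.
\<close>

lemma (in ring) prime_ring_iff:
  "prime_ring R \<longleftrightarrow> carrier R \<noteq> {\<zero>} \<and>
    (\<forall>a\<in>carrier R. \<forall>b\<in>carrier R. (\<forall>x\<in>carrier R. a \<otimes> x \<otimes> b = \<zero>) \<longrightarrow> a = \<zero> \<or> b = \<zero>)"
proof (intro iffI conjI ballI impI)
  assume prime: "prime_ring R"
  then show "carrier R \<noteq> {\<zero>}"
    by (simp add: prime_ring_def)
  fix a b assume a: "a \<in> carrier R" and b: "b \<in> carrier R"
    and axb: "\<forall>x\<in>carrier R. a \<otimes> x \<otimes> b = \<zero>"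
  define J where "J = {y \<in> carrier R. \<forall>x\<in>carrier R. a \<otimes> x \<otimes> y = \<zero>}"
  define I where "I = {z \<in> carrier R. \<forall>x\<in>carrier R. \<forall>y\<in>J. z \<otimes> x \<otimes> y = \<zero>}"
  have J: "ideal J R"
  proof (rule idealI[OF ring_axioms])
    show "subgroup J (add_monoid R)"
      by (rule add.subgroupI) (auto simp: J_def a r_distr r_minus)
  next
    fix y r assume y: "y \<in> J" and r: "r \<in> carrier R"
    have "a \<otimes> x \<otimes> (r \<otimes> y) = \<zero>" if "x \<in> carrier R" for x
    proof -
      have "a \<otimes> x \<otimes> (r \<otimes> y) = a \<otimes> (x \<otimes> r) \<otimes> y"
        using y r a that by (simp add: J_def m_assoc)
      then show ?thesis using y r that by (simp add: J_def)
    qed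
    then show "r \<otimes> y \<in> J" using y r by (simp add: J_def)
    have "a \<otimes> x \<otimes> (y \<otimes> r) = \<zero>" if "x \<in> carrier R" for x
    proof -
      have "a \<otimes> x \<otimes> (y \<otimes> r) = a \<otimes> x \<otimes> y \<otimes> r"
        using y r a that by (simp add: J_def m_assoc)
      then show ?thesis using y r that by (simp add: J_def)
    qed
    then show "y \<otimes> r \<in> J" using y r by (simp add: J_def)
  qed
  have JD: "y \<in> carrier R" if "y \<in> J" for y using that by (simp add: J_def)
  have I: "ideal I R"
  proof (rule idealI[OF ring_axioms])
    show "subgroup I (add_monoid R)"
      by (rule add.subgroupI) (auto simp: I_def JD l_distr l_minus)
  next
    fix z r assume z: "z \<in> I" and r: "r \<in> carrier R"
    have "r \<otimes> z \<otimes> x \<otimes> y = \<zero>" if "x \<in> carrier R" "y \<in> J" for x y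
    proof -
      have "r \<otimes> z \<otimes> x \<otimes> y = r \<otimes> (z \<otimes> x \<otimes> y)"
        using z r that JD by (simp add: I_def m_assoc)
      then show ?thesis using z r that by (simp add: I_def)
    qed
    then show "r \<otimes> z \<in> I" using z r by (simp add: I_def)
    have "z \<otimes> r \<otimes> x \<otimes> y = \<zero>" if "x \<in> carrier R" "y \<in> J" for x y
    proof -
      have "z \<otimes> r \<otimes> x \<otimes> y = z \<otimes> (r \<otimes> x) \<otimes> y"
        using z r that JD by (simp add: I_def m_assoc)
      then show ?thesis using z r that by (simp add: I_def)
    qed
    then show "z \<otimes> r \<in> I" using z r by (simp add: I_def)
  qed
  have "I \<cdot> J \<subseteq> {\<zero>}"
  proof
    fix s assume "s \<in> I \<cdot> J"
    then show "s \<in> {\<zero>}"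
    proof induction
      case (prod i j)
      then have "i \<otimes> \<one> \<otimes> j = \<zero>" unfolding I_def by blast
      then show ?case using prod by (simp add: I_def)
    qed simp
  qed
  moreover have "\<zero> \<otimes> \<zero> \<in> I \<cdot> J"
    using I J by (intro ideal_prod.prod) (auto intro: additive_subgroup.zero_closed ideal.axioms(1))
  then have "\<zero> \<in> I \<cdot> J" by simp
  ultimately have "I \<cdot> J = {\<zero>}" by blast
  then have "I = {\<zero>} \<or> J = {\<zero>}"
    using prime I J by (simp add: prime_ring_def)
  moreover have "a \<in> I" "b \<in> J"
    using a b axb by (auto simp: I_def J_def)
  ultimately show "a = \<zero> \<or> b = \<zero>" by blast
next
  assume *: "carrier R \<noteq> {\<zero>} \<and>
    (\<forall>a\<in>carrier R. \<forall>b\<in>carrier R. (\<forall>x\<in>carrier R. a \<otimes> x \<otimes> b = \<zero>) \<longrightarrow> a = \<zero> \<or> b = \<zero>)"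
  have "I = {\<zero>} \<or> J = {\<zero>}" if I: "ideal I R" and J: "ideal J R" and IJ: "I \<cdot> J = {\<zero>}" for I J
  proof (rule ccontr)
    assume neg: "\<not> ?thesis"
    have "\<zero> \<in> I" "\<zero> \<in> J"
      using I J by (auto intro: additive_subgroup.zero_closed ideal.axioms(1))
    then obtain a b where ab: "a \<in> I" "a \<noteq> \<zero>" "b \<in> J" "b \<noteq> \<zero>"
      using neg by blast
    have "a \<otimes> x \<otimes> b = \<zero>" if "x \<in> carrier R" for x
      using ideal_prod.prod[OF ideal.I_r_closed[OF I ab(1) that] ab(3), of R] IJ by simp
    moreover have "a \<in> carrier R" "b \<in> carrier R"
      using ab I J by (auto intro: ideal.Icarr)
    ultimately show False using * ab by blast
  qed
  then show "prime_ring R"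
    using * by (simp add: prime_ring_def)
qed


section \<open>Linear functionals\<close>

context vector_space
begin

definition dual :: "('b \<Rightarrow> 'a) set"
  where "dual = {f. Vector_Spaces.linear scale (*) f}"

lemma vector_space_pair_field: "vector_space_pair scale ((*) :: 'a \<Rightarrow> 'a \<Rightarrow> 'a)"
  by unfold_locales (auto simp: algebra_simps)

lemma dual_iff: "f \<in> dual \<longleftrightarrow> (\<forall>x y. f (x + y) = f x + f y) \<and> (\<forall>a x. f (scale a x) = a * f x)"
proof -
  interpret p: vector_space_pair scale "(*) :: 'a \<Rightarrow> 'a \<Rightarrow> 'a"
    by (rule vector_space_pair_field)
  show ?thesis by (auto simp: dual_def Vector_Spaces.linear_iff vector_space_axioms p.vs2.vector_space_axioms)
qed

lemma dual_add: "f \<in> dual \<Longrightarrow> f (x + y) = f x + f y"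
  and dual_scale: "f \<in> dual \<Longrightarrow> f (scale a x) = a * f x"
  by (auto simp: dual_iff)

lemma dual_zero: "f \<in> dual \<Longrightarrow> f 0 = 0"
  using dual_scale[of f 0 0] by simp

lemma dual_diff: "f \<in> dual \<Longrightarrow> f (x - y) = f x - f y"
  using dual_add[of f "x - y" y] by simp

lemma zero_in_dual: "(\<lambda>_. 0) \<in> dual"
  and add_in_dual: "f \<in> dual \<Longrightarrow> g \<in> dual \<Longrightarrow> (\<lambda>x. f x + g x) \<in> dual"
  and scale_in_dual: "f \<in> dual \<Longrightarrow> (\<lambda>x. a * f x) \<in> dual"
  by (auto simp: dual_iff algebra_simps)

text \<open>
  A basis of \<open>K\<close> stays independent when \<open>c\<close> is added, so a functional may be prescribed on it.
  This is the source of all functionals in the proof: they separate points, and the orthogonal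
  space of a proper subspace is non-zero.
\<close>

lemma ex_dual_separating:
  assumes K: "subspace K" and c: "c \<notin> K"
  obtains f where "f \<in> dual" "\<And>x. x \<in> K \<Longrightarrow> f x = 0" "f c = 1"
proof -
  interpret p: vector_space_pair scale "(*) :: 'a \<Rightarrow> 'a \<Rightarrow> 'a"
    by (rule vector_space_pair_field)
  obtain B where B: "B \<subseteq> K" "independent B" "K \<subseteq> span B"
    using maximal_independent_subset[of K] by blast
  then have "span B \<subseteq> K" using K by (simp add: span_minimal)
  then have "independent (insert c B)"
    using B(2) c by (intro independent_insertI) auto
  then obtain f where f: "Vector_Spaces.linear scale (*) f"
      "\<forall>x\<in>insert c B. f x = (if x = c then 1 else 0)"
    using p.linear_independent_extend[of "insert c B" "\<lambda>x. if x = c then 1 else 0"] by blast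
  have fd: "f \<in> dual" using f by (simp add: dual_def)
  have "f x = 0" if "x \<in> K" for x
  proof -
    have "x \<in> span B" using that B by blast
    then show ?thesis
    proof (induction x rule: span_induct)
      case base
      show ?case using fd by (auto simp: subspace_def dual_zero dual_add dual_scale)
    next
      case (step x)
      then show ?case using f B c by auto
    qed
  qed
  moreover have "f c = 1" using f by simp
  ultimately show thesis using that fd by blast
qed

lemma dual_eqI:
  assumes "\<And>f. f \<in> dual \<Longrightarrow> f x = f y"
  shows "x = y"
proof (rule ccontr)
  assume "x \<noteq> y"
  then have "x - y \<notin> {0}" by simp
  then obtain f where "f \<in> dual" "f (x - y) = 1"
    using ex_dual_separating[OF subspace_single_0] by metis
  then show False using assms[of f] by (simp add: dual_diff)
qed

end


section \<open>Algebra structures on the dual space and their two actions\<close>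

text \<open>
  The situation of a coalgebra \<open>C\<close>, seen through its dual space only: \<open>lact f c\<close> is
  \<open>f \<rightharpoonup> c\<close> and \<open>ract f c\<close> is \<open>c \<leftharpoonup> f\<close>. The two actions are the transposes of right and
  left multiplication. Because functionals separate points, these two equations determine the
  actions and force all their properties: linearity, the module laws, and the fact that they
  commute with each other, which is associativity of \<open>conv\<close>.
\<close>

locale dual_actions = vector_space scale
  for scale :: "'k::field \<Rightarrow> 'c::ab_group_add \<Rightarrow> 'c" +
  fixes conv :: "('c \<Rightarrow> 'k) \<Rightarrow> ('c \<Rightarrow> 'k) \<Rightarrow> ('c \<Rightarrow> 'k)"
    and unit :: "'c \<Rightarrow> 'k"
    and lact :: "('c \<Rightarrow> 'k) \<Rightarrow> 'c \<Rightarrow> 'c"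
    and ract :: "('c \<Rightarrow> 'k) \<Rightarrow> 'c \<Rightarrow> 'c"
  assumes conv_closed: "f \<in> dual \<Longrightarrow> g \<in> dual \<Longrightarrow> conv f g \<in> dual"
    and unit_closed: "unit \<in> dual"
    and conv_assoc: "f \<in> dual \<Longrightarrow> g \<in> dual \<Longrightarrow> h \<in> dual \<Longrightarrow>
      conv (conv f g) h = conv f (conv g h)"
    and conv_unit_left: "f \<in> dual \<Longrightarrow> conv unit f = f"
    and conv_unit_right: "f \<in> dual \<Longrightarrow> conv f unit = f"
    and conv_lact: "f \<in> dual \<Longrightarrow> g \<in> dual \<Longrightarrow> conv f g c = f (lact g c)"
    and conv_ract: "f \<in> dual \<Longrightarrow> g \<in> dual \<Longrightarrow> conv f g c = g (ract f c)"
begin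

text \<open>
  Passing to the opposite algebra exchanges the two actions. Every fact about \<open>lact\<close> thus has a
  mirror image for \<open>ract\<close>.
\<close>

lemma swap: "dual_actions scale (\<lambda>f g. conv g f) unit ract lact"
  by unfold_locales
    (auto simp: conv_closed unit_closed conv_assoc conv_unit_left conv_unit_right conv_lact
      simp flip: conv_ract)

lemma lact_add: "f \<in> dual \<Longrightarrow> lact f (x + y) = lact f x + lact f y"
  by (rule dual_eqI) (simp add: dual_add conv_closed flip: conv_lact)

lemma lact_scale: "f \<in> dual \<Longrightarrow> lact f (scale a x) = scale a (lact f x)"
  by (rule dual_eqI) (simp add: dual_scale conv_closed flip: conv_lact)

lemma lact_zero: "f \<in> dual \<Longrightarrow> lact f 0 = 0"
  using lact_scale[of f 0 0] by simp

lemma lact_conv: "f \<in> dual \<Longrightarrow> g \<in> dual \<Longrightarrow> lact (conv f g) x = lact f (lact g x)"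
  by (rule dual_eqI) (simp add: conv_closed conv_assoc[symmetric] flip: conv_lact)

lemma lact_unit: "lact unit x = x"
  by (rule dual_eqI) (simp add: unit_closed conv_unit_right flip: conv_lact)

lemma lact_add_functional:
  "f \<in> dual \<Longrightarrow> g \<in> dual \<Longrightarrow> lact (\<lambda>c. f c + g c) x = lact f x + lact g x"
  by (rule dual_eqI)
    (simp add: add_in_dual dual_add conv_ract flip: conv_lact)

lemma lact_scale_functional: "f \<in> dual \<Longrightarrow> lact (\<lambda>c. a * f c) x = scale a (lact f x)"
  by (rule dual_eqI) (simp add: scale_in_dual dual_scale conv_ract flip: conv_lact)

lemma lact_zero_functional: "lact (\<lambda>_. 0) x = 0"
  by (rule dual_eqI) (simp add: zero_in_dual dual_zero conv_ract flip: conv_lact)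

lemma lact_ract: "f \<in> dual \<Longrightarrow> g \<in> dual \<Longrightarrow> lact f (ract g x) = ract g (lact f x)"
  by (rule dual_eqI) (simp add: conv_closed conv_assoc flip: conv_lact conv_ract)

lemma lact_faithful:
  assumes "f \<in> dual"
  shows "(\<forall>x. lact f x = 0) \<longleftrightarrow> f = (\<lambda>_. 0)"
proof
  assume "\<forall>x. lact f x = 0"
  then show "f = (\<lambda>_. 0)"
    using conv_lact[OF unit_closed assms] assms
    by (simp add: fun_eq_iff conv_unit_left dual_zero unit_closed)
qed (simp add: lact_zero_functional)

text \<open>
  For a coalgebra these are the subcoalgebras.
\<close>

definition biinvariant :: "'c set \<Rightarrow> bool"
  where "biinvariant K \<longleftrightarrow> subspace K \<and> (\<forall>f\<in>dual. \<forall>x\<in>K. lact f x \<in> K \<and> ract f x \<in> K)"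

lemma biinvariant_swap: "dual_actions.biinvariant scale ract lact = biinvariant"
  by (auto simp: fun_eq_iff biinvariant_def dual_actions.biinvariant_def[OF swap])

text \<open>
  The heart of the matter. The functional \<open>f * h * g\<close> maps \<open>c\<close> to \<open>f (h \<rightharpoonup> g \<rightharpoonup> c)\<close>, so that
  \<open>f * h * g = 0\<close> for all \<open>h\<close> says that \<open>f\<close> vanishes on everything reached from the range of
  \<open>g \<rightharpoonup>\<close>. A biinvariant subspace between this range and the kernel of \<open>f\<close> is proper if
  \<open>f \<noteq> 0\<close>; conversely, a proper subspace is killed by some \<open>f \<noteq> 0\<close>.
\<close>

lemma lact_coprime_iff_prime:
  "(\<forall>K. biinvariant K \<and> K \<noteq> UNIV \<longrightarrow> (\<forall>f\<in>dual. range (lact f) \<subseteq> K \<longrightarrow> f = (\<lambda>_. 0))) \<longleftrightarrow>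
   (\<forall>f\<in>dual. \<forall>g\<in>dual. (\<forall>h\<in>dual. conv (conv f h) g = (\<lambda>_. 0)) \<longrightarrow> f = (\<lambda>_. 0) \<or> g = (\<lambda>_. 0))"
  (is "?coprime \<longleftrightarrow> ?prime")
proof
  assume coprime: ?coprime
  show ?prime
  proof (intro ballI impI)
    fix f g assume f: "f \<in> dual" and g: "g \<in> dual" and 0: "\<forall>h\<in>dual. conv (conv f h) g = (\<lambda>_. 0)"
    interpret swap: dual_actions scale "\<lambda>f g. conv g f" unit ract lact by (rule swap)
    \<comment> \<open>the largest biinvariant subspace contained in the kernel of \<open>f\<close>\<close>
    define K where "K = {c. \<forall>h\<in>dual. \<forall>h'\<in>dual. f (lact h (ract h' c)) = 0}"
    have "biinvariant K"
      unfolding biinvariant_def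
    proof (intro conjI ballI)
      show "subspace K"
        using f by (auto simp: K_def subspace_def lact_add swap.lact_add lact_scale
            swap.lact_scale lact_zero swap.lact_zero dual_zero dual_add dual_scale)
    next
      fix u x assume u: "u \<in> dual" and x: "x \<in> K"
      show "lact u x \<in> K"
        unfolding K_def
      proof (intro CollectI ballI)
        fix h h' assume h: "h \<in> dual" "h' \<in> dual"
        have "f (lact h (ract h' (lact u x))) = f (lact (conv h u) (ract h' x))"
          using h u by (simp add: lact_ract lact_conv)
        then show "f (lact h (ract h' (lact u x))) = 0"
          using h u x by (simp add: K_def conv_closed)
      qed
      show "ract u x \<in> K"
        using u x by (auto simp: K_def conv_closed simp flip: swap.lact_conv)
    qed
    moreover have "range (lact g) \<subseteq> K"
    proof -
      have "f (lact h (ract h' (lact g c))) = 0" if h: "h \<in> dual" "h' \<in> dual" for h h' c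
      proof -
        have "f (lact h (ract h' (lact g c))) = f (lact h (lact g (ract h' c)))"
          using h g by (simp add: lact_ract)
        also have "\<dots> = conv (conv f h) g (ract h' c)"
          using h f g by (simp add: conv_lact conv_closed)
        finally show ?thesis using 0 h by simp
      qed
      then show ?thesis by (auto simp: K_def)
    qed
    moreover have "f = (\<lambda>_. 0)" if "K = UNIV"
    proof
      fix c
      have "c \<in> K" using that by simp
      then have "f (lact unit (ract unit c)) = 0"
        unfolding K_def using unit_closed by blast
      then show "f c = 0" by (simp add: lact_unit swap.lact_unit)
    qed
    ultimately show "f = (\<lambda>_. 0) \<or> g = (\<lambda>_. 0)"
      using coprime g by blast
  qed
next
  assume prime: ?prime
  show ?coprime
  proof (intro allI impI ballI)
    fix K g assume K: "biinvariant K \<and> K \<noteq> UNIV" and g: "g \<in> dual" and gK: "range (lact g) \<subseteq> K"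
    obtain c where c: "c \<notin> K" using K by blast
    then obtain f where f: "f \<in> dual" "\<And>x. x \<in> K \<Longrightarrow> f x = 0" "f c = 1"
      using ex_dual_separating K unfolding biinvariant_def by metis
    have "conv (conv f h) g = (\<lambda>_. 0)" if "h \<in> dual" for h
      using that f g K gK by (auto simp: fun_eq_iff conv_lact conv_closed biinvariant_def)
    then have "f = (\<lambda>_. 0) \<or> g = (\<lambda>_. 0)"
      using prime f g by blast
    then show "g = (\<lambda>_. 0)" using f(3) by auto
  qed
qed

text \<open>
  The condition on the algebra is the same for the opposite algebra; this is what makes the left
  and the right notions of coprimeness agree.
\<close>

lemma ract_coprime_iff_prime:
  "(\<forall>K. biinvariant K \<and> K \<noteq> UNIV \<longrightarrow> (\<forall>f\<in>dual. range (ract f) \<subseteq> K \<longrightarrow> f = (\<lambda>_. 0))) \<longleftrightarrow>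
   (\<forall>f\<in>dual. \<forall>g\<in>dual. (\<forall>h\<in>dual. conv (conv f h) g = (\<lambda>_. 0)) \<longrightarrow> f = (\<lambda>_. 0) \<or> g = (\<lambda>_. 0))"
  (is "_ \<longleftrightarrow> ?prime")
proof -
  have "?prime \<longleftrightarrow> (\<forall>f\<in>dual. \<forall>g\<in>dual.
      (\<forall>h\<in>dual. conv (conv g h) f = (\<lambda>_. 0)) \<longrightarrow> f = (\<lambda>_. 0) \<or> g = (\<lambda>_. 0))"
    by blast
  also have "\<dots> \<longleftrightarrow> (\<forall>f\<in>dual. \<forall>g\<in>dual.
      (\<forall>h\<in>dual. conv g (conv h f) = (\<lambda>_. 0)) \<longrightarrow> f = (\<lambda>_. 0) \<or> g = (\<lambda>_. 0))"
    by (intro ball_cong refl arg_cong2[where f = "(\<longrightarrow>)"]) (simp_all add: conv_assoc)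
  finally show ?thesis
    using dual_actions.lact_coprime_iff_prime[OF swap] unfolding biinvariant_swap by simp
qed

end


section \<open>Modules over the dual algebra\<close>

text \<open>
  The common form of the modules attached to right and to left comodule structures.
\<close>

definition action_module :: "('f \<Rightarrow> 'c::ab_group_add \<Rightarrow> 'c) \<Rightarrow> ('f, 'c) module"
  where "action_module act =
    \<lparr>carrier = UNIV, mult = undefined, one = undefined, zero = 0, add = (+), smult = act\<rparr>"

lemma action_module_simps [simp]:
  "carrier (action_module act) = UNIV"
  "\<zero>\<^bsub>action_module act\<^esub> = 0"
  "x \<oplus>\<^bsub>action_module act\<^esub> y = x + y"
  "f \<odot>\<^bsub>action_module act\<^esub> x = act f x"
  by (simp_all add: action_module_def)

lemma abelian_group_action_module: "abelian_group (action_module act)"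
proof (rule abelian_groupI)
  show "\<exists>y\<in>carrier (action_module act). y \<oplus>\<^bsub>action_module act\<^esub> x = \<zero>\<^bsub>action_module act\<^esub>" for x
    by (auto intro: exI[of _ "- x"])
qed (auto simp: algebra_simps)

lemma a_inv_action_module [simp]: "\<ominus>\<^bsub>action_module act\<^esub> x = - x"
  by (rule abelian_group.minus_equality[OF abelian_group_action_module]) auto

lemma coset_action_module: "K +>\<^bsub>action_module act\<^esub> x = (\<lambda>k. k + x) ` K"
  by (auto simp: a_r_coset_def')

lemma (in vector_space) subspace_coset_eq:
  assumes "subspace K"
  shows "K +>\<^bsub>action_module act\<^esub> x = K +>\<^bsub>action_module act\<^esub> y \<longleftrightarrow> x - y \<in> K"
proof
  assume "K +>\<^bsub>action_module act\<^esub> x = K +>\<^bsub>action_module act\<^esub> y"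
  moreover have "x \<in> K +>\<^bsub>action_module act\<^esub> x"
    using assms by (auto simp: coset_action_module image_iff subspace_0)
  ultimately show "x - y \<in> K"
    by (auto simp: coset_action_module)
next
  assume xy: "x - y \<in> K"
  have "k + x \<in> (\<lambda>k. k + y) ` K" if "k \<in> K" for k
    by (rule image_eqI[of _ _ "k + (x - y)"]) (use that xy assms in \<open>auto intro: subspace_add\<close>)
  moreover have "k + y \<in> (\<lambda>k. k + x) ` K" if "k \<in> K" for k
    by (rule image_eqI[of _ _ "k - (x - y)"]) (use that xy assms in \<open>auto intro: subspace_diff\<close>)
  ultimately show "K +>\<^bsub>action_module act\<^esub> x = K +>\<^bsub>action_module act\<^esub> y"
    by (auto simp: coset_action_module)
qed

text \<open>
  A scalar that kills \<open>N\<close> kills direct sums of copies of \<open>N\<close> and their homomorphic images.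
\<close>

lemma generated_by_imp_annihilator_subset:
  fixes M :: "('a, 'm, 'x) module_scheme" and N :: "('a, 'n, 'y) module_scheme"
  assumes M: "abelian_group M" and N: "abelian_monoid N" and gen: "generated_by A M N"
  shows "annihilator A N \<subseteq> annihilator A M"
proof
  fix a assume a: "a \<in> annihilator A N"
  interpret M: abelian_group M by (rule M)
  interpret N: abelian_monoid N by (rule N)
  obtain I :: "('n \<Rightarrow> 'm) set" and h where h: "h \<in> module_homs A (direct_sum_copies I N) M"
    and onto: "h ` carrier (direct_sum_copies I N) = carrier M"
    using gen unfolding generated_by_def by blast
  let ?S = "direct_sum_copies I N"
  have zero: "\<zero>\<^bsub>?S\<^esub> \<in> carrier ?S" "\<zero>\<^bsub>?S\<^esub> \<oplus>\<^bsub>?S\<^esub> \<zero>\<^bsub>?S\<^esub> = \<zero>\<^bsub>?S\<^esub>"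
    by (auto simp: direct_sum_copies_def)
  have "h (\<zero>\<^bsub>?S\<^esub> \<oplus>\<^bsub>?S\<^esub> \<zero>\<^bsub>?S\<^esub>) = h \<zero>\<^bsub>?S\<^esub> \<oplus>\<^bsub>M\<^esub> h \<zero>\<^bsub>?S\<^esub>"
    using h zero(1) unfolding module_homs_def by blast
  moreover have "h \<zero>\<^bsub>?S\<^esub> \<in> carrier M"
    using h zero(1) unfolding module_homs_def by blast
  ultimately have h0: "h \<zero>\<^bsub>?S\<^esub> = \<zero>\<^bsub>M\<^esub>"
    unfolding zero(2) by (metis M.add.r_cancel_one)
  have "a \<odot>\<^bsub>M\<^esub> x = \<zero>\<^bsub>M\<^esub>" if x: "x \<in> carrier M" for x
  proof -
    obtain u where u: "u \<in> carrier ?S" "x = h u"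
      using onto x by blast
    have "a \<odot>\<^bsub>?S\<^esub> u = \<zero>\<^bsub>?S\<^esub>"
      using u a by (auto simp: direct_sum_copies_def annihilator_def fun_eq_iff)
    moreover have "h (a \<odot>\<^bsub>?S\<^esub> u) = a \<odot>\<^bsub>M\<^esub> h u"
      using h u(1) a unfolding module_homs_def annihilator_def by blast
    ultimately show ?thesis
      using h0 u(2) by simp
  qed
  then show "a \<in> annihilator A M"
    using a by (simp add: annihilator_def)
qed

text \<open>
  With one summand for each homomorphism from \<open>N\<close>, the sum of all these homomorphisms is a
  homomorphism on the direct sum. Its image contains the images of all of them, and hence is the
  whole module as soon as no proper submodule contains these images.
\<close>

lemma generated_by_action_moduleI:
  fixes N :: "('a, 'n, 'y) module_scheme" and act :: "'a \<Rightarrow> 'm::ab_group_add \<Rightarrow> 'm"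
  assumes N: "abelian_group N"
    and smult_closed: "\<And>a x. a \<in> carrier A \<Longrightarrow> x \<in> carrier N \<Longrightarrow> a \<odot>\<^bsub>N\<^esub> x \<in> carrier N"
    and smult_zero: "\<And>a. a \<in> carrier A \<Longrightarrow> a \<odot>\<^bsub>N\<^esub> \<zero>\<^bsub>N\<^esub> = \<zero>\<^bsub>N\<^esub>"
    and act_add: "\<And>a x y. a \<in> carrier A \<Longrightarrow> act a (x + y) = act a x + act a y"
    and images: "\<And>U. U \<noteq> {} \<Longrightarrow> (\<And>x y. x \<in> U \<Longrightarrow> y \<in> U \<Longrightarrow> x + y \<in> U) \<Longrightarrow>
      (\<And>a x. a \<in> carrier A \<Longrightarrow> x \<in> U \<Longrightarrow> act a x \<in> U) \<Longrightarrow>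
      (\<And>h. h \<in> module_homs A N (action_module act) \<Longrightarrow> h ` carrier N \<subseteq> U) \<Longrightarrow> U = UNIV"
  shows "generated_by A (action_module act) N"
proof -
  interpret N: abelian_group N by (rule N)
  define I where "I = module_homs A N (action_module act)"
  define supp where "supp u = {i\<in>I. u i \<noteq> \<zero>\<^bsub>N\<^esub>}" for u
  define H where "H u = (\<Sum>i\<in>supp u. i (u i))" for u
  let ?S = "direct_sum_copies I N"
  have I: "i (x \<oplus>\<^bsub>N\<^esub> y) = i x + i y" "a \<in> carrier A \<Longrightarrow> i (a \<odot>\<^bsub>N\<^esub> x) = act a (i x)"
    if "i \<in> I" "x \<in> carrier N" "y \<in> carrier N" for i x y a
    using that by (auto simp: I_def module_homs_def)
  have I0: "i \<zero>\<^bsub>N\<^esub> = 0" if "i \<in> I" for i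
    using I(1)[OF that, of "\<zero>\<^bsub>N\<^esub>" "\<zero>\<^bsub>N\<^esub>"] by simp
  have S: "u \<in> carrier ?S \<longleftrightarrow> u \<in> I \<rightarrow>\<^sub>E carrier N \<and> finite (supp u)" for u
    by (simp add: direct_sum_copies_def supp_def)
  \<comment> \<open>enlarging the support allows \<open>H\<close> of a sum and of a multiple to be computed over one index set\<close>
  have H: "H u = (\<Sum>i\<in>T. i (u i))" if "finite T" "supp u \<subseteq> T" "T \<subseteq> I" for u T
    unfolding H_def using that I0 by (intro sum.mono_neutral_left) (auto simp: supp_def)
  have act_zero: "act a 0 = 0" if "a \<in> carrier A" for a
    using act_add[OF that, of 0 0] by simp
  have act_sum: "act a (\<Sum>i\<in>T. g i) = (\<Sum>i\<in>T. act a (g i))" if "a \<in> carrier A" for a g and T :: "('n \<Rightarrow> 'm) set"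
    using that by (induction T rule: infinite_finite_induct) (auto simp: act_zero act_add)
  have Hadd: "H (u \<oplus>\<^bsub>?S\<^esub> v) = H u + H v" and add_closed: "u \<oplus>\<^bsub>?S\<^esub> v \<in> carrier ?S"
    if u: "u \<in> carrier ?S" and v: "v \<in> carrier ?S" for u v
  proof -
    have w: "(u \<oplus>\<^bsub>?S\<^esub> v) i = u i \<oplus>\<^bsub>N\<^esub> v i" if "i \<in> I" for i
      using that by (simp add: direct_sum_copies_def)
    have sub: "supp (u \<oplus>\<^bsub>?S\<^esub> v) \<subseteq> supp u \<union> supp v"
      using w by (auto simp: supp_def)
    have T: "finite (supp u \<union> supp v)" "supp u \<union> supp v \<subseteq> I"
      using u v by (auto simp: S) (auto simp: supp_def)
    have "H (u \<oplus>\<^bsub>?S\<^esub> v) = (\<Sum>i\<in>supp u \<union> supp v. i (u i \<oplus>\<^bsub>N\<^esub> v i))"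
      unfolding H[OF T(1) sub T(2)] using T by (intro sum.cong) (auto simp: w)
    also have "\<dots> = (\<Sum>i\<in>supp u \<union> supp v. i (u i) + i (v i))"
      using T u v by (intro sum.cong refl I) (auto simp: S)
    also have "\<dots> = H u + H v"
      using H[OF T(1) _ T(2), of u] H[OF T(1) _ T(2), of v] by (simp add: sum.distrib)
    finally show "H (u \<oplus>\<^bsub>?S\<^esub> v) = H u + H v" .
    show "u \<oplus>\<^bsub>?S\<^esub> v \<in> carrier ?S"
      unfolding S using u[unfolded S] v[unfolded S] finite_subset[OF sub T(1)]
      by (simp add: direct_sum_copies_def PiE_iff)
  qed
  have Hsmult: "H (a \<odot>\<^bsub>?S\<^esub> u) = act a (H u)" and smult_closed': "a \<odot>\<^bsub>?S\<^esub> u \<in> carrier ?S"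
    if u: "u \<in> carrier ?S" and a: "a \<in> carrier A" for u a
  proof -
    have w: "(a \<odot>\<^bsub>?S\<^esub> u) i = a \<odot>\<^bsub>N\<^esub> u i" if "i \<in> I" for i
      using that by (simp add: direct_sum_copies_def)
    have sub: "supp (a \<odot>\<^bsub>?S\<^esub> u) \<subseteq> supp u"
      using w smult_zero[OF a] by (auto simp: supp_def)
    have T: "finite (supp u)" "supp u \<subseteq> I"
      using u by (auto simp: S) (auto simp: supp_def)
    have "H (a \<odot>\<^bsub>?S\<^esub> u) = (\<Sum>i\<in>supp u. i (a \<odot>\<^bsub>N\<^esub> u i))"
      unfolding H[OF T(1) sub T(2)] using T by (intro sum.cong) (auto simp: w)
    also have "\<dots> = (\<Sum>i\<in>supp u. act a (i (u i)))"
      using T u a by (intro sum.cong refl I) (auto simp: S)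
    finally show "H (a \<odot>\<^bsub>?S\<^esub> u) = act a (H u)" by (simp add: act_sum a H_def)
    show "a \<odot>\<^bsub>?S\<^esub> u \<in> carrier ?S"
      unfolding S using u[unfolded S] finite_subset[OF sub T(1)] smult_closed[OF a]
      by (simp add: direct_sum_copies_def PiE_iff)
  qed
  have "H ` carrier ?S = UNIV"
  proof (rule images)
    have "(\<lambda>i\<in>I. \<zero>\<^bsub>N\<^esub>) \<in> carrier ?S" by (simp add: S supp_def)
    then show "H ` carrier ?S \<noteq> {}" by blast
  next
    fix i assume i: "i \<in> module_homs A N (action_module act)"
    show "i ` carrier N \<subseteq> H ` carrier ?S"
    proof (rule image_subsetI)
      fix x assume x: "x \<in> carrier N"
      let ?u = "\<lambda>j\<in>I. if j = i then x else \<zero>\<^bsub>N\<^esub>"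
      have sub: "supp ?u \<subseteq> {i}" by (auto simp: supp_def)
      then have "?u \<in> carrier ?S"
        using x finite_subset[OF sub] by (auto simp: S)
      moreover have "H ?u = i x"
        using H[OF _ sub] i by (simp add: I_def)
      ultimately show "i x \<in> H ` carrier ?S" by (metis imageI)
    qed
  next
    fix x y assume "x \<in> H ` carrier ?S" "y \<in> H ` carrier ?S"
    then obtain u v where "x = H u" "y = H v" "u \<in> carrier ?S" "v \<in> carrier ?S" by blast
    then show "x + y \<in> H ` carrier ?S"
      using add_closed by (simp flip: Hadd)
  next
    fix a x assume "a \<in> carrier A" "x \<in> H ` carrier ?S"
    then obtain u where "a \<in> carrier A" "x = H u" "u \<in> carrier ?S" by blast
    then show "act a x \<in> H ` carrier ?S"
      using smult_closed' by (simp flip: Hsmult)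
  qed
  moreover have "H \<in> module_homs A ?S (action_module act)"
    by (simp add: module_homs_def Hadd Hsmult)
  ultimately show ?thesis
    unfolding generated_by_def by fastforce
qed

context dual_actions
begin

definition functional_ring :: "('c \<Rightarrow> 'k) ring"
  where "functional_ring =
    \<lparr>carrier = dual, mult = conv, one = unit, zero = (\<lambda>c. 0), add = (\<lambda>f g c. f c + g c)\<rparr>"

lemma functional_ring_simps [simp]:
  "carrier functional_ring = dual"
  "f \<otimes>\<^bsub>functional_ring\<^esub> g = conv f g"
  "\<one>\<^bsub>functional_ring\<^esub> = unit"
  "\<zero>\<^bsub>functional_ring\<^esub> = (\<lambda>c. 0)"
  "f \<oplus>\<^bsub>functional_ring\<^esub> g = (\<lambda>c. f c + g c)"
  by (simp_all add: functional_ring_def)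

lemma opposite_functional_ring:
  "opposite_ring functional_ring = dual_actions.functional_ring scale (\<lambda>f g. conv g f) unit"
  by (simp add: opposite_ring_def functional_ring_def dual_actions.functional_ring_def[OF swap])

lemma ring_functional_ring: "ring functional_ring"
proof (rule ringI)
  show "abelian_group functional_ring"
  proof (rule abelian_groupI)
    fix f assume "f \<in> carrier functional_ring"
    then show "\<exists>g\<in>carrier functional_ring. g \<oplus>\<^bsub>functional_ring\<^esub> f = \<zero>\<^bsub>functional_ring\<^esub>"
      using scale_in_dual[of f "- 1"] by (intro bexI[of _ "\<lambda>c. - f c"]) auto
  qed (auto simp: zero_in_dual add_in_dual algebra_simps)
  show "monoid functional_ring"
    by (rule monoidI) (auto simp: unit_closed conv_closed conv_assoc conv_unit_left conv_unit_right)
  show "(f \<oplus>\<^bsub>functional_ring\<^esub> g) \<otimes>\<^bsub>functional_ring\<^esub> h =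
      f \<otimes>\<^bsub>functional_ring\<^esub> h \<oplus>\<^bsub>functional_ring\<^esub> g \<otimes>\<^bsub>functional_ring\<^esub> h"
    if "f \<in> carrier functional_ring" "g \<in> carrier functional_ring" "h \<in> carrier functional_ring" for f g h
    using that by (simp add: fun_eq_iff conv_lact add_in_dual)
  show "h \<otimes>\<^bsub>functional_ring\<^esub> (f \<oplus>\<^bsub>functional_ring\<^esub> g) =
      h \<otimes>\<^bsub>functional_ring\<^esub> f \<oplus>\<^bsub>functional_ring\<^esub> h \<otimes>\<^bsub>functional_ring\<^esub> g"
    if "f \<in> carrier functional_ring" "g \<in> carrier functional_ring" "h \<in> carrier functional_ring" for f g h
    using that by (simp add: fun_eq_iff conv_ract add_in_dual)
qed

lemma prime_functional_ring_iff:
  assumes "\<exists>c::'c. c \<noteq> 0"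
  shows "prime_ring functional_ring \<longleftrightarrow>
   (\<forall>f\<in>dual. \<forall>g\<in>dual. (\<forall>h\<in>dual. conv (conv f h) g = (\<lambda>_. 0)) \<longrightarrow> f = (\<lambda>_. 0) \<or> g = (\<lambda>_. 0))"
proof -
  obtain c :: 'c where "c \<notin> {0}" using assms by auto
  then obtain f where "f \<in> dual" "f c = 1"
    using ex_dual_separating[OF subspace_single_0] by metis
  then have "dual \<noteq> {\<lambda>_. 0}" by auto
  then show ?thesis
    by (simp add: ring.prime_ring_iff[OF ring_functional_ring])
qed

text \<open>
  Submodules are closed under scalars because multiples of the unit functional act as scalars.
\<close>

lemma submodule_action_module_iff:
  "submodule K functional_ring (action_module lact) \<longleftrightarrow>
   subspace K \<and> (\<forall>f\<in>dual. \<forall>x\<in>K. lact f x \<in> K)"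
proof
  assume "submodule K functional_ring (action_module lact)"
  then interpret K: submodule K functional_ring "action_module lact" .
  have act: "lact f x \<in> K" if "f \<in> dual" "x \<in> K" for f x
    using K.smult_closed[of f x] that by simp
  have "scale a x \<in> K" if "x \<in> K" for a x
    using act[OF scale_in_dual[OF unit_closed, of a] that]
    by (simp add: lact_scale_functional unit_closed lact_unit)
  then show "subspace K \<and> (\<forall>f\<in>dual. \<forall>x\<in>K. lact f x \<in> K)"
    using K.one_closed K.m_closed act by (simp add: subspace_def)
next
  assume K: "subspace K \<and> (\<forall>f\<in>dual. \<forall>x\<in>K. lact f x \<in> K)"
  interpret M: abelian_group "action_module lact" by (rule abelian_group_action_module)
  have "subgroup K (add_monoid (action_module lact))"
    using K by (intro M.add.subgroupI)
      (auto simp: subspace_neg subspace_add a_inv_action_module[unfolded a_inv_def] dest: subspace_0)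
  then show "submodule K functional_ring (action_module lact)"
    using K by (simp add: submodule_def submodule_axioms_def)
qed

text \<open>
  An endomorphism \<open>h\<close> is recovered from the functional \<open>u = unit \<circ> h\<close>: for every functional
  \<open>f\<close>, \<open>f (h x) = unit (f \<rightharpoonup> h x) = u (f \<rightharpoonup> x) = f (x \<leftharpoonup> u)\<close>.
\<close>

lemma module_homs_self:
  "module_homs functional_ring (action_module lact) (action_module lact) = ract ` dual"
proof -
  interpret swap: dual_actions scale "\<lambda>f g. conv g f" unit ract lact by (rule swap)
  show ?thesis
  proof (intro equalityI subsetI)
    fix h assume "h \<in> module_homs functional_ring (action_module lact) (action_module lact)"
    then have h: "h (x + y) = h x + h y" "f \<in> dual \<Longrightarrow> h (lact f x) = lact f (h x)" for x y f
      by (auto simp: module_homs_def)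
    have scale: "h (scale a x) = scale a (h x)" for a x
      using h(2)[OF scale_in_dual[OF unit_closed, of a], of x]
      by (simp add: lact_scale_functional unit_closed lact_unit)
    define u where "u x = unit (h x)" for x
    have u: "u \<in> dual"
      using unit_closed by (simp add: u_def dual_iff h scale)
    have "h = ract u"
    proof (rule ext, rule dual_eqI)
      fix f x assume f: "f \<in> dual"
      have "f (h x) = conv unit f (h x)"
        using f by (simp add: conv_unit_left)
      also have "\<dots> = u (lact f x)"
        using f by (simp add: conv_lact unit_closed u_def h)
      also have "\<dots> = f (ract u x)"
        using f u by (simp flip: conv_lact conv_ract)
      finally show "f (h x) = f (ract u x)" .
    qed
    then show "h \<in> ract ` dual" using u by blast
  next
    fix h assume "h \<in> ract ` dual"
    then show "h \<in> module_homs functional_ring (action_module lact) (action_module lact)"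
      by (auto simp: module_homs_def swap.lact_add lact_ract)
  qed
qed

lemma fully_invariant_iff_biinvariant:
  "fully_invariant_submodule K functional_ring (action_module lact) \<longleftrightarrow> biinvariant K"
  unfolding fully_invariant_submodule_def submodule_action_module_iff module_homs_self biinvariant_def
  by blast

lemma annihilator_action_module: "annihilator functional_ring (action_module lact) = {\<lambda>_. 0}"
  by (auto simp: annihilator_def lact_faithful lact_zero_functional zero_in_dual)

lemma quotient_module_simps:
  "carrier (quotient_module (action_module lact) K) = range (\<lambda>x. K +>\<^bsub>action_module lact\<^esub> x)"
  "\<zero>\<^bsub>quotient_module (action_module lact) K\<^esub> = K"
  by (auto simp: quotient_module_def A_RCOSETS_def RCOSETS_def a_r_coset_def)

lemma quotient_module_add:
  assumes "subspace K"
  shows "(K +>\<^bsub>action_module lact\<^esub> x) \<oplus>\<^bsub>quotient_module (action_module lact) K\<^esub>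
    (K +>\<^bsub>action_module lact\<^esub> y) = K +>\<^bsub>action_module lact\<^esub> (x + y)"
proof -
  have "k + (x + y) = (k + x) + (0 + y)" for k by simp
  then have "\<exists>l\<in>K. \<exists>l'\<in>K. k + (x + y) = (l + x) + (l' + y)" if "k \<in> K" for k
    using that subspace_0[OF assms] by blast
  moreover have "\<exists>m\<in>K. (k + x) + (l + y) = m + (x + y)" if "k \<in> K" "l \<in> K" for k l
    by (rule bexI[of _ "k + l"]) (use that assms in \<open>auto simp: subspace_add\<close>)
  ultimately show ?thesis
    by (auto simp: quotient_module_def set_add_def' coset_action_module image_iff)
qed

lemma quotient_module_smult:
  assumes K: "subspace K" and f: "f \<in> dual" and fK: "\<And>x. x \<in> K \<Longrightarrow> lact f x \<in> K"
  shows "f \<odot>\<^bsub>quotient_module (action_module lact) K\<^esub> (K +>\<^bsub>action_module lact\<^esub> x) =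
    K +>\<^bsub>action_module lact\<^esub> lact f x"
proof -
  let ?coset = "\<lambda>x. K +>\<^bsub>action_module lact\<^esub> x"
  have const: "?coset (lact f z) = ?coset (lact f x)" if "z \<in> ?coset x" for z
  proof -
    obtain k where "k \<in> K" "z = k + x"
      using \<open>z \<in> ?coset x\<close> by (auto simp: coset_action_module)
    then show ?thesis
      using f fK by (simp add: subspace_coset_eq[OF K] lact_add)
  qed
  have x: "x \<in> ?coset x"
    using subspace_0[OF K] by (auto simp: coset_action_module image_iff)
  have "(\<Union>z\<in>?coset x. ?coset (lact f z)) = ?coset (lact f x)"
    by (rule UN_constant_eq[OF x]) (intro ballI const)
  then show ?thesis by (simp add: quotient_module_def)
qed

lemma abelian_group_quotient_module:
  assumes K: "subspace K"
  shows "abelian_group (quotient_module (action_module lact) K)"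
proof (rule abelian_groupI)
  let ?N = "quotient_module (action_module lact) K"
  have zero: "K = K +>\<^bsub>action_module lact\<^esub> 0" by (simp add: coset_action_module)
  show "\<zero>\<^bsub>?N\<^esub> \<in> carrier ?N"
    unfolding quotient_module_simps using zero by (rule range_eqI)
  show "\<zero>\<^bsub>?N\<^esub> \<oplus>\<^bsub>?N\<^esub> X = X" if X: "X \<in> carrier ?N" for X
  proof -
    obtain x where "X = K +>\<^bsub>action_module lact\<^esub> x"
      using X unfolding quotient_module_simps by blast
    then show ?thesis
      using quotient_module_add[OF K, of 0 x] zero by (simp add: quotient_module_simps)
  qed
  show "\<exists>Y\<in>carrier ?N. Y \<oplus>\<^bsub>?N\<^esub> X = \<zero>\<^bsub>?N\<^esub>" if X: "X \<in> carrier ?N" for X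
  proof -
    obtain x where "X = K +>\<^bsub>action_module lact\<^esub> x"
      using X unfolding quotient_module_simps by blast
    then show ?thesis
      using quotient_module_add[OF K, of "- x" x] zero[symmetric]
      by (intro bexI[of _ "K +>\<^bsub>action_module lact\<^esub> (- x)"]) (auto simp: quotient_module_simps)
  qed
qed (auto simp: quotient_module_simps quotient_module_add[OF K] algebra_simps)

lemma annihilator_quotient_module:
  assumes K: "subspace K" and inv: "\<And>f x. f \<in> dual \<Longrightarrow> x \<in> K \<Longrightarrow> lact f x \<in> K"
  shows "annihilator functional_ring (quotient_module (action_module lact) K) =
    {f \<in> dual. range (lact f) \<subseteq> K}"
proof -
  have 1: "K +>\<^bsub>action_module lact\<^esub> x = K \<longleftrightarrow> x \<in> K" for x
    using subspace_coset_eq[OF K, of lact x 0] by (simp add: coset_action_module[of _ K 0])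
  have 2: "f \<in> annihilator functional_ring (quotient_module (action_module lact) K) \<longleftrightarrow>
      f \<in> dual \<and> (\<forall>x. K +>\<^bsub>action_module lact\<^esub> lact f x = K)" for f
    by (auto simp: annihilator_def quotient_module_simps quotient_module_smult[OF K] inv)
  show ?thesis
    by (rule Set.set_eqI) (simp only: 1 2 mem_Collect_eq image_subset_iff ball_UNIV)
qed

lemma coprime_action_module_iff:
  assumes "\<exists>c::'c. c \<noteq> 0"
  shows "coprime_module functional_ring (action_module lact) \<longleftrightarrow>
    (\<forall>K. biinvariant K \<and> K \<noteq> UNIV \<longrightarrow> (\<forall>f\<in>dual. range (lact f) \<subseteq> K \<longrightarrow> f = (\<lambda>_. 0)))"
proof -
  have "annihilator functional_ring (quotient_module (action_module lact) K) =
      annihilator functional_ring (action_module lact) \<longleftrightarrow>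
      (\<forall>f\<in>dual. range (lact f) \<subseteq> K \<longrightarrow> f = (\<lambda>_. 0))" if K: "biinvariant K \<and> K \<noteq> UNIV" for K
  proof -
    have "annihilator functional_ring (quotient_module (action_module lact) K) =
        {f \<in> dual. range (lact f) \<subseteq> K}"
      using K by (intro annihilator_quotient_module) (auto simp: biinvariant_def)
    moreover have "range (lact (\<lambda>_. 0)) \<subseteq> K"
      using K by (auto simp: lact_zero_functional biinvariant_def subspace_0)
    ultimately show ?thesis
      unfolding annihilator_action_module using zero_in_dual by blast
  qed
  moreover have "(UNIV :: 'c set) \<noteq> {0}" using assms by auto
  ultimately show ?thesis
    unfolding coprime_module_def fully_invariant_iff_biinvariant action_module_simps
    by (simp only: simp_thms cong: imp_cong)
qed



section \<open>Left ideals and modules generated by quotients\<close>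

lemma left_ideal_functional_ringD:
  assumes "left_ideal I functional_ring"
  shows "I \<subseteq> dual" "(\<lambda>_. 0) \<in> I" "f \<in> dual \<Longrightarrow> g \<in> I \<Longrightarrow> conv f g \<in> I"
  using assms additive_subgroup.a_subset[of I functional_ring]
    additive_subgroup.zero_closed[of I functional_ring]
  by (auto simp: left_ideal_def)

text \<open>
  Invariance under \<open>lact\<close> comes from the left ideal, invariance under \<open>ract\<close> from the fact that
  the two actions commute.
\<close>

lemma biinvariant_ideal_smult:
  assumes I: "left_ideal I functional_ring"
  shows "biinvariant (ideal_smult (action_module lact) I)" (is "biinvariant ?J")
proof -
  interpret swap: dual_actions scale "\<lambda>f g. conv g f" unit ract lact by (rule swap)
  note ID = left_ideal_functional_ringD[OF I]
  have gen: "lact f x \<in> ?J" if "f \<in> I" for f x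
    using ideal_smult.smult[of f I x "action_module lact"] that by simp
  have add: "x + y \<in> ?J" if "x \<in> ?J" "y \<in> ?J" for x y
    using ideal_smult.add[OF that] by simp
  have lact: "lact f x \<in> ?J" if "f \<in> dual" "x \<in> ?J" for f x
    using that(2)
  proof induction
    case (smult g x)
    then show ?case
      using that(1) ID gen[of "conv f g" x] by (auto simp: lact_conv subset_iff)
  qed (auto simp: lact_add that(1) intro: add)
  have ract: "ract f x \<in> ?J" if "f \<in> dual" "x \<in> ?J" for f x
    using that(2)
  proof induction
    case (smult g x)
    then have "lact g (ract f x) \<in> ?J" by (intro gen)
    then show ?case using that(1) ID smult by (auto simp: lact_ract subset_iff)
  qed (auto simp: swap.lact_add that(1) intro: add)
  have "0 \<in> ?J"
    using gen[OF ID(2), of 0] by (simp add: lact_zero_functional)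
  moreover have "scale a x \<in> ?J" if "x \<in> ?J" for a x
    using lact[OF scale_in_dual[OF unit_closed, of a] that]
    by (simp add: lact_scale_functional unit_closed lact_unit)
  ultimately show ?thesis
    using add lact ract by (auto simp: biinvariant_def subspace_def)
qed

lemma left_ideal_into_submodule:
  assumes K: "subspace K" and inv: "\<And>f x. f \<in> dual \<Longrightarrow> x \<in> K \<Longrightarrow> lact f x \<in> K"
  shows "left_ideal {f \<in> dual. range (lact f) \<subseteq> K} functional_ring" (is "left_ideal ?I _")
proof -
  interpret ring functional_ring by (rule ring_functional_ring)
  have minus: "\<ominus>\<^bsub>functional_ring\<^esub> f = (\<lambda>c. - f c)" if "f \<in> dual" for f
    using scale_in_dual[OF that, of "- 1"] that by (intro minus_equality) auto
  have "subgroup ?I (add_monoid functional_ring)"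
  proof (rule add.subgroupI)
    show "?I \<noteq> {}"
      using zero_in_dual K by (auto simp: lact_zero_functional subspace_0 intro!: exI[of _ "\<lambda>_. 0"])
  next
    fix f assume "f \<in> ?I"
    then show "\<ominus>\<^bsub>functional_ring\<^esub> f \<in> ?I"
      using scale_in_dual[of f "- 1"] lact_scale_functional[of f "- 1"] K
      by (auto simp: minus subspace_neg)
  qed (auto simp: add_in_dual lact_add_functional intro!: subspace_add[OF K])
  then show ?thesis
    by (auto simp: left_ideal_def additive_subgroup_def conv_closed lact_conv intro: inv)
qed

text \<open>
  From left to right, take \<open>K = I \<rightharpoonup> C\<close>. From right to left, the functionals \<open>f\<close> with
  \<open>f \<rightharpoonup> C \<subseteq> K\<close> form a left ideal \<open>I\<close>, and \<open>I \<rightharpoonup> C \<subseteq> K\<close> rules out \<open>I \<rightharpoonup> C = C\<close>.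
\<close>

lemma lact_coprime_iff_left_ideals:
  "(\<forall>K. biinvariant K \<and> K \<noteq> UNIV \<longrightarrow> (\<forall>f\<in>dual. range (lact f) \<subseteq> K \<longrightarrow> f = (\<lambda>_. 0))) \<longleftrightarrow>
   (\<forall>I. left_ideal I functional_ring \<longrightarrow>
     ideal_smult (action_module lact) I = {0} \<or> ideal_smult (action_module lact) I = UNIV)"
  (is "?coprime \<longleftrightarrow> ?ideals")
proof
  assume coprime: ?coprime
  show ?ideals
  proof (intro allI impI)
    fix I assume I: "left_ideal I functional_ring"
    let ?J = "ideal_smult (action_module lact) I"
    have J: "biinvariant ?J" by (rule biinvariant_ideal_smult[OF I])
    have range: "range (lact f) \<subseteq> ?J" if "f \<in> I" for f
      using ideal_smult.smult[of f I _ "action_module lact"] that by auto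
    have "x = 0" if "?J \<noteq> UNIV" "x \<in> ?J" for x
      using that(2)
    proof induction
      case (smult f x)
      then have "f = (\<lambda>_. 0)"
        using coprime J that(1) range left_ideal_functional_ringD(1)[OF I] by blast
      then show ?case by (simp add: lact_zero_functional)
    qed simp
    moreover have "0 \<in> ?J" using J by (simp add: biinvariant_def subspace_0)
    ultimately show "?J = {0} \<or> ?J = UNIV" by blast
  qed
next
  assume ideals: ?ideals
  show ?coprime
  proof (intro allI impI ballI)
    fix K f assume K: "biinvariant K \<and> K \<noteq> UNIV" and f: "f \<in> dual" "range (lact f) \<subseteq> K"
    let ?I = "{f \<in> dual. range (lact f) \<subseteq> K}"
    let ?J = "ideal_smult (action_module lact) ?I"
    have "left_ideal ?I functional_ring"
      using K by (intro left_ideal_into_submodule) (auto simp: biinvariant_def)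
    moreover have "x \<in> K" if "x \<in> ?J" for x
      using that K by induction (auto simp: biinvariant_def subspace_add)
    ultimately have "?J = {0}" using ideals K by blast
    moreover have "lact f x \<in> ?J" for x
      using ideal_smult.smult[of f ?I x "action_module lact"] f by simp
    ultimately have "\<forall>x. lact f x = 0" by blast
    then show "f = (\<lambda>_. 0)" using lact_faithful f by blast
  qed
qed

text \<open>
  If \<open>u\<close> vanishes on \<open>K\<close>, then so does \<open>k \<mapsto> k \<leftharpoonup> u\<close>, because
  \<open>f (k \<leftharpoonup> u) = u (f \<rightharpoonup> k) = 0\<close> for every functional \<open>f\<close>.
\<close>

lemma quotient_hom_of_vanishing:
  assumes K: "biinvariant K" and u: "u \<in> dual" "\<And>x. x \<in> K \<Longrightarrow> u x = 0"
  obtains h where "h \<in> module_homs functional_ring (quotient_module (action_module lact) K) (action_module lact)"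
    "\<And>x. h (K +>\<^bsub>action_module lact\<^esub> x) = ract u x"
proof -
  interpret swap: dual_actions scale "\<lambda>f g. conv g f" unit ract lact by (rule swap)
  have sub: "subspace K" using K by (simp add: biinvariant_def)
  have 0: "ract u k = 0" if k: "k \<in> K" for k
  proof (rule dual_eqI)
    fix f assume f: "f \<in> dual"
    have "f (ract u k) = u (lact f k)"
      using f u by (simp flip: conv_lact conv_ract)
    then show "f (ract u k) = f 0"
      using f u K k by (simp add: biinvariant_def dual_zero)
  qed
  \<comment> \<open>the image of a coset of \<open>K\<close> under \<open>ract u\<close> is a singleton\<close>
  define h where "h X = the_elem (ract u ` X)" for X
  have h: "h (K +>\<^bsub>action_module lact\<^esub> x) = ract u x" for x
  proof -
    have "ract u ` (K +>\<^bsub>action_module lact\<^esub> x) = {ract u x}"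
      using subspace_0[OF sub] u
      by (auto simp: coset_action_module swap.lact_add 0 image_image image_iff intro!: bexI[of _ 0])
    then show ?thesis by (simp add: h_def)
  qed
  have "h \<in> module_homs functional_ring (quotient_module (action_module lact) K) (action_module lact)"
    using K u by (auto simp: module_homs_def quotient_module_simps quotient_module_add[OF sub]
        quotient_module_smult[OF sub] biinvariant_def h swap.lact_add lact_ract)
  then show thesis using h by (rule that)
qed

text \<open>
  A module generated by \<open>C / K\<close> has at least the annihilator of \<open>C / K\<close>, which gives one
  direction. For the other one, the maps \<open>ract u\<close> with \<open>u\<close> vanishing on \<open>K\<close> factor through
  \<open>C / K\<close>. Their images span a biinvariant subspace; were it proper, it would contradict
  coprimeness for \<open>ract\<close>, which is equivalent to coprimeness for \<open>lact\<close>.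
\<close>

lemma fully_coprime_action_module_iff:
  assumes "\<exists>c::'c. c \<noteq> 0"
  shows "fully_coprime_module functional_ring (action_module lact) \<longleftrightarrow>
    (\<forall>K. biinvariant K \<and> K \<noteq> UNIV \<longrightarrow> (\<forall>f\<in>dual. range (lact f) \<subseteq> K \<longrightarrow> f = (\<lambda>_. 0)))"
    (is "_ \<longleftrightarrow> ?coprime")
proof
  assume full: "fully_coprime_module functional_ring (action_module lact)"
  show ?coprime
  proof (intro allI impI ballI)
    fix K f assume K: "biinvariant K \<and> K \<noteq> UNIV" and f: "f \<in> dual" "range (lact f) \<subseteq> K"
    let ?N = "quotient_module (action_module lact) K"
    have N: "abelian_group ?N"
      using K by (intro abelian_group_quotient_module) (simp add: biinvariant_def)
    have gen: "generated_by functional_ring (action_module lact) ?N"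
      using full K unfolding fully_coprime_module_def fully_invariant_iff_biinvariant by simp
    have "annihilator functional_ring ?N = {f \<in> dual. range (lact f) \<subseteq> K}"
      using K by (intro annihilator_quotient_module) (auto simp: biinvariant_def)
    then have "f \<in> annihilator functional_ring ?N" using f by simp
    then have "f \<in> annihilator functional_ring (action_module lact)"
      using generated_by_imp_annihilator_subset[OF abelian_group_action_module _ gen]
        abelian_group.axioms(1)[OF N] by blast
    then show "f = (\<lambda>_. 0)" by (simp add: annihilator_action_module)
  qed
next
  assume ?coprime
  then have coprime: "\<forall>K. biinvariant K \<and> K \<noteq> UNIV \<longrightarrow>
      (\<forall>f\<in>dual. range (ract f) \<subseteq> K \<longrightarrow> f = (\<lambda>_. 0))"
    unfolding lact_coprime_iff_prime ract_coprime_iff_prime .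
  interpret swap: dual_actions scale "\<lambda>f g. conv g f" unit ract lact by (rule swap)
  have "generated_by functional_ring (action_module lact) (quotient_module (action_module lact) K)"
    if K: "biinvariant K" and proper: "K \<noteq> UNIV" for K
  proof -
    let ?N = "quotient_module (action_module lact) K"
    have sub: "subspace K" and inv: "\<And>f x. f \<in> dual \<Longrightarrow> x \<in> K \<Longrightarrow> lact f x \<in> K"
      using K by (auto simp: biinvariant_def)
    define P where "P = {u \<in> dual. \<forall>x\<in>K. u x = 0}"
    define T where "T = {ract u x |u x. u \<in> P}"
    have T_lact: "lact f x \<in> T" if "x \<in> T" "f \<in> dual" for f x
    proof -
      obtain u y where u: "x = ract u y" "u \<in> P" using \<open>x \<in> T\<close> by (auto simp: T_def)
      then have "lact f x = ract u (lact f y)"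
        using \<open>f \<in> dual\<close> by (simp add: P_def lact_ract)
      then show ?thesis using u by (auto simp: T_def)
    qed
    have T_ract: "ract f x \<in> T" if "x \<in> T" "f \<in> dual" for f x
    proof -
      obtain u y where u: "x = ract u y" "u \<in> P" using \<open>x \<in> T\<close> by (auto simp: T_def)
      have "conv u f \<in> P"
        using u \<open>f \<in> dual\<close> inv by (auto simp: P_def conv_closed conv_lact)
      moreover have "ract f x = ract (conv u f) y"
        using u \<open>f \<in> dual\<close> by (simp add: P_def swap.lact_conv)
      ultimately show ?thesis by (auto simp: T_def)
    qed
    have "biinvariant (span T)"
      unfolding biinvariant_def
    proof (intro conjI ballI)
      fix f x assume f: "f \<in> dual" and x: "x \<in> span T"
      show "lact f x \<in> span T"
        using x
      proof (induction x rule: span_induct)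
        case base
        show ?case
          using f by (auto simp: subspace_def lact_add lact_scale lact_zero span_add span_scale span_zero)
      qed (use f in \<open>auto intro: span_base T_lact\<close>)
      show "ract f x \<in> span T"
        using x
      proof (induction x rule: span_induct)
        case base
        show ?case
          using f by (auto simp: subspace_def swap.lact_add swap.lact_scale swap.lact_zero
              span_add span_scale span_zero)
      qed (use f in \<open>auto intro: span_base T_ract\<close>)
    qed simp
    moreover obtain c where c: "c \<notin> K" using proper by blast
    obtain u where u: "u \<in> dual" "\<And>x. x \<in> K \<Longrightarrow> u x = 0" "u c = 1"
      using ex_dual_separating[OF sub c] by metis
    then have "range (ract u) \<subseteq> span T"
      by (auto simp: T_def P_def intro!: span_base)
    moreover have "u \<noteq> (\<lambda>_. 0)" using u(3) by auto
    ultimately have T: "span T = UNIV"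
      using coprime u(1) by blast
    show ?thesis
    proof (rule generated_by_action_moduleI)
      show "abelian_group ?N" by (rule abelian_group_quotient_module[OF sub])
    next
      fix f X assume "f \<in> carrier functional_ring" "X \<in> carrier ?N"
      then show "f \<odot>\<^bsub>?N\<^esub> X \<in> carrier ?N"
        by (auto simp: quotient_module_simps quotient_module_smult[OF sub _ inv])
    next
      fix f assume "f \<in> carrier functional_ring"
      then show "f \<odot>\<^bsub>?N\<^esub> \<zero>\<^bsub>?N\<^esub> = \<zero>\<^bsub>?N\<^esub>"
        using quotient_module_smult[OF sub _ inv, of f 0]
        by (simp add: quotient_module_simps coset_action_module lact_zero)
    next
      fix U assume ne: "U \<noteq> {}" and add: "\<And>x y. x \<in> U \<Longrightarrow> y \<in> U \<Longrightarrow> x + y \<in> U"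
        and act: "\<And>f x. f \<in> carrier functional_ring \<Longrightarrow> x \<in> U \<Longrightarrow> lact f x \<in> U"
        and homs: "\<And>h. h \<in> module_homs functional_ring ?N (action_module lact) \<Longrightarrow> h ` carrier ?N \<subseteq> U"
      have scale: "scale a x \<in> U" if "x \<in> U" for a x
        using act[of "\<lambda>c. a * unit c" x] that
        by (simp add: scale_in_dual unit_closed lact_scale_functional lact_unit)
      have "0 \<in> U" using ne scale[of _ 0] by auto
      then have "subspace U" using add scale by (simp add: subspace_def)
      moreover have "T \<subseteq> U"
      proof
        fix y assume "y \<in> T"
        then obtain u x where y: "y = ract u x" "u \<in> P" by (auto simp: T_def)
        then obtain h where h: "h \<in> module_homs functional_ring ?N (action_module lact)"
            "h (K +>\<^bsub>action_module lact\<^esub> x) = ract u x"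
          using quotient_hom_of_vanishing[OF K, of u] unfolding P_def by blast
        have "h (K +>\<^bsub>action_module lact\<^esub> x) \<in> U"
          using homs[OF h(1)] by (auto simp: quotient_module_simps)
        then show "y \<in> U" using h y by simp
      qed
      ultimately show "U = UNIV" using span_minimal T by blast
    qed (simp add: lact_add)
  qed
  moreover have "(UNIV :: 'c set) \<noteq> {0}" using assms by auto
  ultimately show "fully_coprime_module functional_ring (action_module lact)"
    unfolding fully_coprime_module_def fully_invariant_iff_biinvariant by simp
qed

end


section \<open>Tensors over a field\<close>

lemma vector_space_field: "vector_space ((*) :: 'k::field \<Rightarrow> 'k \<Rightarrow> 'k)"
  by unfold_locales (auto simp: algebra_simps)

lemma (in vector_space) free_extend_gen: "free_extend scale b (free_gen p) = b p"
  by (simp add: free_extend_def)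

lemma linear_apply_free_extend:
  assumes "Vector_Spaces.linear s1 s2 E"
  shows "E (free_extend s1 b t) = free_extend s2 (\<lambda>p. E (b p)) t"
proof -
  interpret Vector_Spaces.linear s1 s2 E by fact
  show ?thesis by (simp add: free_extend_def sum scale)
qed

lemma free_extend_free_gen: "free_extend free_scale free_gen t = t"
proof (rule poly_mapping_eqI)
  fix p
  have "Poly_Mapping.lookup (\<Sum>q\<in>Poly_Mapping.keys t. g q) p = (\<Sum>q\<in>Poly_Mapping.keys t. Poly_Mapping.lookup (g q) p)"
    for g :: "'a \<Rightarrow> 'a \<Rightarrow>\<^sub>0 'b"
    by (rule Poly_Mapping.lookup_sum)
  then show "Poly_Mapping.lookup (free_extend free_scale free_gen t) p = Poly_Mapping.lookup t p"
    by (simp add: free_extend_def Poly_Mapping.lookup_single when_def sum.delta in_keys_iff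
        if_distrib cong: if_cong)
qed

lemma linearity_relations_add:
  "free_gen (e (v + w)) - free_gen (e v) - free_gen (e w) \<in> linearity_relations s e"
  and linearity_relations_scale:
  "free_gen (e (s a v)) - free_scale a (free_gen (e v)) \<in> linearity_relations s e"
  by (auto simp: linearity_relations_def)

text \<open>
  Bilinear forms detect zero in the tensor product: a functional on the free vector space that
  kills the relations is a bilinear form.
\<close>

lemma tensor_nullI:
  fixes sM :: "'k::field \<Rightarrow> 'm::ab_group_add \<Rightarrow> 'm" and sN :: "'k \<Rightarrow> 'n::ab_group_add \<Rightarrow> 'n"
  assumes M: "vector_space sM" and N: "vector_space sN"
    and bilinear: "\<And>b. (\<And>y. Vector_Spaces.linear sM (*) (\<lambda>x. b x y)) \<Longrightarrow>
      (\<And>x. Vector_Spaces.linear sN (*) (\<lambda>y. b x y)) \<Longrightarrow> free_extend (*) (\<lambda>(x, y). b x y) t = 0"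
  shows "t \<in> tensor_null sM sN"
proof (rule ccontr)
  assume t: "t \<notin> tensor_null sM sN"
  interpret F: vector_space "free_scale :: 'k \<Rightarrow> ('m \<times> 'n \<Rightarrow>\<^sub>0 'k) \<Rightarrow> _"
    by (rule vector_space_free_scale)
  have "F.subspace (tensor_null sM sN)"
    unfolding tensor_null_def by (rule F.subspace_span)
  then obtain \<phi> where \<phi>: "\<phi> \<in> F.dual" "\<And>u. u \<in> tensor_null sM sN \<Longrightarrow> \<phi> u = 0" "\<phi> t = 1"
    using F.ex_dual_separating[OF _ t] by metis
  define b where "b x y = \<phi> (free_gen (x, y))" for x y
  have rel: "\<phi> r = 0" if "r \<in> (\<Union>y. linearity_relations sM (\<lambda>x. (x, y))) \<union> (\<Union>x. linearity_relations sN (\<lambda>y. (x, y)))" for r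
    using \<phi>(2) F.span_base[OF that] unfolding tensor_null_def by blast
  have left: "b (v + w) y = b v y + b w y" "b (sM a v) y = a * b v y" for v w y a
  proof -
    have "\<phi> (free_gen (v + w, y) - free_gen (v, y) - free_gen (w, y)) = 0"
      by (rule rel, rule UnI1, rule UN_I[OF UNIV_I], rule linearity_relations_add[of "\<lambda>x. (x, y)"])
    then show "b (v + w) y = b v y + b w y"
      using \<phi>(1) by (simp add: b_def F.dual_diff diff_diff_eq F.dual_add)
    have "\<phi> (free_gen (sM a v, y) - free_scale a (free_gen (v, y))) = 0"
      by (rule rel, rule UnI1, rule UN_I[OF UNIV_I], rule linearity_relations_scale[of "\<lambda>x. (x, y)" sM])
    then show "b (sM a v) y = a * b v y"
      using \<phi>(1) by (simp add: b_def F.dual_diff F.dual_scale)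
  qed
  have right: "b x (v + w) = b x v + b x w" "b x (sN a v) = a * b x v" for v w x a
  proof -
    have "\<phi> (free_gen (x, v + w) - free_gen (x, v) - free_gen (x, w)) = 0"
      by (rule rel, rule UnI2, rule UN_I[OF UNIV_I], rule linearity_relations_add[of "\<lambda>y. (x, y)"])
    then show "b x (v + w) = b x v + b x w"
      using \<phi>(1) by (simp add: b_def F.dual_diff diff_diff_eq F.dual_add)
    have "\<phi> (free_gen (x, sN a v) - free_scale a (free_gen (x, v))) = 0"
      by (rule rel, rule UnI2, rule UN_I[OF UNIV_I], rule linearity_relations_scale[of "\<lambda>y. (x, y)" sN])
    then show "b x (sN a v) = a * b x v"
      using \<phi>(1) by (simp add: b_def F.dual_diff F.dual_scale)
  qed
  have "\<phi> t = \<phi> (free_extend free_scale free_gen t)"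
    by (simp add: free_extend_free_gen)
  also have "\<dots> = free_extend (*) (\<lambda>p. \<phi> (free_gen p)) t"
    using \<phi>(1) by (intro linear_apply_free_extend) (simp add: F.dual_def)
  also have "(\<lambda>p. \<phi> (free_gen p)) = (\<lambda>(x, y). b x y)"
    by (auto simp: b_def)
  also have "free_extend (*) (\<lambda>(x, y). b x y) t = 0"
    by (rule bilinear) (simp_all add: Vector_Spaces.linear_iff M N vector_space_field left right)
  finally show False using \<phi>(3) by simp
qed

text \<open>
  Over a field, every tensor is the sum of the \<open>(I \<otimes> b\<^sup>*) t \<otimes> b\<close>, where \<open>b\<close> ranges over
  finitely many elements of a basis of the second factor and \<open>b\<^sup>*\<close>, here \<open>\<delta> b\<close>, is the
  coordinate functional of \<open>b\<close>. The left components thus are contractions of \<open>t\<close>, which is how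
  statements about the action of functionals yield statements about tensors.
\<close>

lemma tensor_expansion:
  fixes sM :: "'k::field \<Rightarrow> 'm::ab_group_add \<Rightarrow> 'm" and sN :: "'k \<Rightarrow> 'n::ab_group_add \<Rightarrow> 'n"
  assumes "vector_space sM" and "vector_space sN"
  obtains S \<delta> where "finite S" "range \<delta> \<subseteq> vector_space.dual sN"
    "t - (\<Sum>b\<in>S. free_gen (free_extend sM (\<lambda>(x, y). sM (\<delta> b y) x) t, b)) \<in> tensor_null sM sN"
proof -
  interpret M: vector_space sM by fact
  interpret N: vector_space sN by fact
  interpret k: vector_space "(*) :: 'k \<Rightarrow> 'k \<Rightarrow> 'k" by (rule vector_space_field)
  define B where "B = N.extend_basis {}"
  have B: "N.independent B" "\<And>y. y \<in> N.span B"
    unfolding B_def by (simp_all add: N.independent_extend_basis N.independent_empty)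
  define \<delta> where "\<delta> b y = N.representation B y b" for b y
  define S where "S = (\<Union>p\<in>Poly_Mapping.keys t. {b. \<delta> b (snd p) \<noteq> 0})"
  have S: "finite S"
    by (simp add: S_def \<delta>_def N.finite_representation)
  have \<delta>: "range \<delta> \<subseteq> N.dual"
    by (simp add: image_subset_iff N.dual_iff \<delta>_def N.representation_add[OF B(1)] N.representation_scale[OF B(1)] B(2))
  have y: "(\<Sum>b\<in>S. sN (\<delta> b y) b) = y" if "(x, y) \<in> Poly_Mapping.keys t" for x y
  proof -
    have "(\<Sum>b | \<delta> b y \<noteq> 0. sN (\<delta> b y) b) = y"
      unfolding \<delta>_def by (rule N.sum_nonzero_representation_eq[OF B])
    moreover have "(\<Sum>b | \<delta> b y \<noteq> 0. sN (\<delta> b y) b) = (\<Sum>b\<in>S. sN (\<delta> b y) b)"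
      using that S by (intro sum.mono_neutral_left) (force simp: S_def)+
    ultimately show ?thesis by simp
  qed
  define c where "c b = free_extend sM (\<lambda>(x, y). sM (\<delta> b y) x) t" for b
  have "t - (\<Sum>b\<in>S. free_gen (c b, b)) \<in> tensor_null sM sN"
  proof (rule tensor_nullI)
    fix \<beta> assume left: "\<And>y. Vector_Spaces.linear sM (*) (\<lambda>x. \<beta> x y)"
      and right: "\<And>x. Vector_Spaces.linear sN (*) (\<lambda>y. \<beta> x y)"
    let ?E = "free_extend (*) (\<lambda>(x, y). \<beta> x y)"
    interpret E: Vector_Spaces.linear free_scale "(*)" ?E
      by (rule k.linear_free_extend)
    have "?E t = (\<Sum>p\<in>Poly_Mapping.keys t. Poly_Mapping.lookup t p *
        (\<Sum>b\<in>S. \<delta> b (snd p) * \<beta> (fst p) b))"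
      unfolding free_extend_def
    proof (intro sum.cong refl arg_cong2[where f = "(*)"])
      fix p assume p: "p \<in> Poly_Mapping.keys t"
      interpret r: Vector_Spaces.linear sN "(*)" "\<beta> (fst p)" by (rule right)
      have "\<beta> (fst p) (snd p) = \<beta> (fst p) (\<Sum>b\<in>S. sN (\<delta> b (snd p)) b)"
        using y[of "fst p" "snd p"] p by simp
      then show "(case p of (x, y) \<Rightarrow> \<beta> x y) = (\<Sum>b\<in>S. \<delta> b (snd p) * \<beta> (fst p) b)"
        by (simp add: case_prod_unfold r.sum r.scale)
    qed
    also have "\<dots> = (\<Sum>b\<in>S. \<Sum>p\<in>Poly_Mapping.keys t.
        Poly_Mapping.lookup t p * (\<delta> b (snd p) * \<beta> (fst p) b))"
      unfolding sum_distrib_left by (rule sum.swap)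
    also have "\<dots> = (\<Sum>b\<in>S. \<beta> (c b) b)"
    proof (rule sum.cong[OF refl])
      fix b
      interpret l: Vector_Spaces.linear sM "(*)" "\<lambda>x. \<beta> x b" by (rule left)
      show "(\<Sum>p\<in>Poly_Mapping.keys t. Poly_Mapping.lookup t p * (\<delta> b (snd p) * \<beta> (fst p) b)) = \<beta> (c b) b"
        by (simp add: c_def free_extend_def l.sum l.scale case_prod_unfold)
    qed
    finally show "?E (t - (\<Sum>b\<in>S. free_gen (c b, b))) = 0"
      by (simp add: E.diff E.sum k.free_extend_gen)
  qed fact+
  then show thesis unfolding c_def by (rule that[OF S \<delta>])
qed

lemma tensor_null_if_contractions_zero:
  fixes sM :: "'k::field \<Rightarrow> 'm::ab_group_add \<Rightarrow> 'm" and sN :: "'k \<Rightarrow> 'n::ab_group_add \<Rightarrow> 'n"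
  assumes M: "vector_space sM" and N: "vector_space sN"
    and zero: "\<And>f. f \<in> vector_space.dual sN \<Longrightarrow> free_extend sM (\<lambda>(x, y). sM (f y) x) t = 0"
  shows "t \<in> tensor_null sM sN"
proof -
  interpret M: vector_space sM by fact
  interpret F: vector_space "free_scale :: 'k \<Rightarrow> ('m \<times> 'n \<Rightarrow>\<^sub>0 'k) \<Rightarrow> _"
    by (rule vector_space_free_scale)
  obtain S and \<delta> :: "'n \<Rightarrow> 'n \<Rightarrow> 'k" where "finite S" "range \<delta> \<subseteq> vector_space.dual sN" and
    t: "t - (\<Sum>b\<in>S. free_gen (free_extend sM (\<lambda>(x, y). sM (\<delta> b y) x) t, b)) \<in> tensor_null sM sN"
    by (rule tensor_expansion[OF M N, of t]) (rule that; assumption)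
  then have t: "t - (\<Sum>b\<in>S. free_gen (0, b)) \<in> tensor_null sM sN"
    by (simp add: zero image_subset_iff)
  have "free_gen (sM 0 0, b) - free_scale 0 (free_gen (0, b)) \<in> tensor_null sM sN" for b
    unfolding tensor_null_def
    by (rule F.span_base, rule UnI1, rule UN_I[OF UNIV_I], rule linearity_relations_scale[of "\<lambda>x. (x, b)" sM])
  then have "(\<Sum>b\<in>S. free_gen (0, b)) \<in> tensor_null sM sN"
    unfolding tensor_null_def by (intro F.span_sum) simp
  from F.span_add[OF t[unfolded tensor_null_def] this[unfolded tensor_null_def]]
  show ?thesis unfolding tensor_null_def diff_add_cancel .
qed

lemma free_extend_tensor3_eq:
  fixes sM :: "'k::field \<Rightarrow> 'm::ab_group_add \<Rightarrow> 'm" and sN :: "'k \<Rightarrow> 'n::ab_group_add \<Rightarrow> 'n"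
    and sP :: "'k \<Rightarrow> 'p::ab_group_add \<Rightarrow> 'p"
  assumes "vector_space sM" "vector_space sN" "vector_space sP"
    and f: "f \<in> vector_space.dual sM" and g: "g \<in> vector_space.dual sN" and h: "h \<in> vector_space.dual sP"
    and "t - u \<in> tensor3_null sM sN sP"
  shows "free_extend (*) (\<lambda>(x, y, z). f x * g y * h z) t = free_extend (*) (\<lambda>(x, y, z). f x * g y * h z) u"
proof -
  interpret M: vector_space sM by fact
  interpret N: vector_space sN by fact
  interpret P: vector_space sP by fact
  interpret k: vector_space "(*) :: 'k \<Rightarrow> 'k \<Rightarrow> 'k" by (rule vector_space_field)
  interpret F: vector_space "free_scale :: 'k \<Rightarrow> ('m \<times> 'n \<times> 'p \<Rightarrow>\<^sub>0 'k) \<Rightarrow> _"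
    by (rule vector_space_free_scale)
  let ?E = "free_extend (*) (\<lambda>(x, y, z). f x * g y * h z)"
  interpret E: Vector_Spaces.linear free_scale "(*)" ?E
    by (rule k.linear_free_extend)
  have gen: "?E (free_gen (x, y, z)) = f x * g y * h z" for x y z
    by (simp add: k.free_extend_gen)
  have left: "f (v + w) * g y * h z = f v * g y * h z + f w * g y * h z"
    "f (sM a v) * g y * h z = a * (f v * g y * h z)" for v w y z a
    using f by (simp_all only: M.dual_add M.dual_scale distrib_right mult.assoc)
  have middle: "f x * g (v + w) * h z = f x * g v * h z + f x * g w * h z"
    "f x * g (sN a v) * h z = a * (f x * g v * h z)" for x v w z a
    using g by (simp_all only: N.dual_add N.dual_scale distrib_left distrib_right mult_ac)
  have right: "f x * g y * h (v + w) = f x * g y * h v + f x * g y * h w"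
    "f x * g y * h (sP a v) = a * (f x * g y * h v)" for x y v w a
    using h by (simp_all only: P.dual_add P.dual_scale distrib_left mult_ac)
  have "?E w = 0" if "w \<in> tensor3_null sM sN sP" for w
    using that unfolding tensor3_null_def
  proof (induction w rule: F.span_induct)
    case base
    show ?case by (auto simp: F.subspace_def E.add E.scale)
  next
    case (step w)
    then show ?case
      by (auto simp: linearity_relations_def E.diff E.scale gen left middle right)
  qed
  from this[OF assms(7)] show ?thesis by (simp add: E.diff)
qed


section \<open>The dual algebra of a coalgebra\<close>

context coalgebra
begin

definition conv :: "('c \<Rightarrow> 'k) \<Rightarrow> ('c \<Rightarrow> 'k) \<Rightarrow> 'c \<Rightarrow> 'k"
  where "conv f g c = tensor_lift (*) (\<lambda>x y. f x * g y) (comult c)"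

definition lact :: "('c \<Rightarrow> 'k) \<Rightarrow> 'c \<Rightarrow> 'c"
  where "lact f c = tensor_lift scale (\<lambda>x y. scale (f y) x) (comult c)"

definition ract :: "('c \<Rightarrow> 'k) \<Rightarrow> 'c \<Rightarrow> 'c"
  where "ract f c = tensor_lift scale (\<lambda>x y. scale (f x) y) (comult c)"

lemma tensor_class_eqI:
  assumes "t - u \<in> tensor_null scale scale"
  shows "tensor_class scale scale t = tensor_class scale scale u"
proof -
  interpret F: vector_space "free_scale :: 'k \<Rightarrow> ('c \<times> 'c \<Rightarrow>\<^sub>0 'k) \<Rightarrow> _"
    by (rule vector_space_free_scale)
  have sub: "F.subspace (tensor_null scale scale)"
    unfolding tensor_null_def by (rule F.subspace_span)
  have "w - t \<in> tensor_null scale scale \<longleftrightarrow> w - u \<in> tensor_null scale scale" for w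
    using F.subspace_add[OF sub _ assms, of "w - t"] F.subspace_diff[OF sub _ assms, of "w - u"]
    by auto
  then show ?thesis by (simp add: tensor_class_def)
qed

lemma tensor_class_self: "t \<in> tensor_class scale scale t"
proof -
  interpret F: vector_space "free_scale :: 'k \<Rightarrow> ('c \<times> 'c \<Rightarrow>\<^sub>0 'k) \<Rightarrow> _"
    by (rule vector_space_free_scale)
  show ?thesis by (simp add: tensor_class_def tensor_null_def F.span_zero)
qed

lemma comult_class:
  obtains v where "comult c = tensor_class scale scale v"
  using comult_linear unfolding tensor_linear_def tensor_space_def by blast

lemma comult_eq_class:
  assumes "t \<in> comult c"
  shows "comult c = tensor_class scale scale t"
proof -
  obtain v where v: "comult c = tensor_class scale scale v" by (rule comult_class)
  then have "t - v \<in> tensor_null scale scale"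
    using assms by (simp add: tensor_class_def)
  then show ?thesis unfolding v by (rule tensor_class_eqI[symmetric])
qed

lemma tensor_rep_comult: "tensor_rep (comult c) \<in> comult c"
proof -
  obtain v where "comult c = tensor_class scale scale v" by (rule comult_class)
  then have "v \<in> comult c" by (simp add: tensor_class_self)
  then show ?thesis unfolding tensor_rep_def by (rule someI)
qed

lemma comult_add: "t \<in> comult c \<Longrightarrow> u \<in> comult d \<Longrightarrow> t + u \<in> comult (c + d)"
  and comult_scale: "t \<in> comult c \<Longrightarrow> free_scale a t \<in> comult (scale a c)"
  using comult_linear by (auto simp: tensor_linear_def)

lemma tensor_lift_comult:
  assumes "vector_space sP"
    and "\<And>y. Vector_Spaces.linear scale sP (\<lambda>x. b x y)"
    and "\<And>x. Vector_Spaces.linear scale sP (\<lambda>y. b x y)"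
    and "t \<in> comult c"
  shows "tensor_lift sP b (comult c) = free_extend sP (\<lambda>(x, y). b x y) t"
proof -
  have "tensor_rep (comult c) - t \<in> tensor_null scale scale"
    using tensor_rep_comult[of c] comult_eq_class[OF assms(4)] by (simp add: tensor_class_def)
  then show ?thesis
    unfolding tensor_lift_def by (rule free_extend_tensor_eq[OF assms(1-3)])
qed

lemma conv_eq:
  assumes f: "f \<in> dual" and g: "g \<in> dual" and t: "t \<in> comult c"
  shows "conv f g c = free_extend (*) (\<lambda>(x, y). f x * g y) t"
  unfolding conv_def
  by (rule tensor_lift_comult[OF vector_space_field _ _ t])
    (simp_all add: Vector_Spaces.linear_iff vector_space_axioms vector_space_field algebra_simps
      dual_add[OF f] dual_scale[OF f] dual_add[OF g] dual_scale[OF g])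

lemma lact_eq:
  assumes f: "f \<in> dual" and t: "t \<in> comult c"
  shows "lact f c = free_extend scale (\<lambda>(x, y). scale (f y) x) t"
  unfolding lact_def
  by (rule tensor_lift_comult[OF vector_space_axioms _ _ t])
    (simp_all add: Vector_Spaces.linear_iff vector_space_axioms algebra_simps
      dual_add[OF f] dual_scale[OF f])

lemma conv_in_dual:
  assumes f: "f \<in> dual" and g: "g \<in> dual"
  shows "conv f g \<in> dual"
proof -
  interpret k: vector_space "(*) :: 'k \<Rightarrow> 'k \<Rightarrow> 'k" by (rule vector_space_field)
  interpret E: Vector_Spaces.linear free_scale "(*)" "free_extend (*) (\<lambda>(x, y). f x * g y)"
    by (rule k.linear_free_extend)
  have "conv f g (c + d) = conv f g c + conv f g d" for c d
    by (simp only: conv_eq[OF f g comult_add[OF tensor_rep_comult[of c] tensor_rep_comult[of d]]]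
        conv_eq[OF f g tensor_rep_comult[of c]] conv_eq[OF f g tensor_rep_comult[of d]] E.add)
  moreover have "conv f g (scale a c) = a * conv f g c" for a c
    by (simp only: conv_eq[OF f g comult_scale[OF tensor_rep_comult[of c]]]
        conv_eq[OF f g tensor_rep_comult[of c]] E.scale)
  ultimately show ?thesis by (simp add: dual_iff)
qed

text \<open>
  Both sides are the value of the trilinear form \<open>f \<otimes> g \<otimes> h\<close> on the iterated
  comultiplication of \<open>c\<close>, bracketed in the two possible ways.
\<close>

lemma conv_coassoc:
  assumes f: "f \<in> dual" and g: "g \<in> dual" and h: "h \<in> dual"
  shows "conv (conv f g) h c = conv f (conv g h) c"
proof -
  interpret k: vector_space "(*) :: 'k \<Rightarrow> 'k \<Rightarrow> 'k" by (rule vector_space_field)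
  interpret F: vector_space "free_scale :: 'k \<Rightarrow> ('c \<times> 'c \<times> 'c \<Rightarrow>\<^sub>0 'k) \<Rightarrow> _"
    by (rule vector_space_free_scale)
  define E where "E = free_extend (*) (\<lambda>(x, y, z). f x * g y * h z)"
  let ?L = "free_extend free_scale (\<lambda>(x, z). free_extend free_scale
    (\<lambda>(u, v). free_gen (u, v, z)) (tensor_rep (comult x))) (tensor_rep (comult c))"
  let ?R = "free_extend free_scale (\<lambda>(x, z). free_extend free_scale
    (\<lambda>(u, v). free_gen (x, u, v)) (tensor_rep (comult z))) (tensor_rep (comult c))"
  have E: "Vector_Spaces.linear free_scale (*) E"
    unfolding E_def by (rule k.linear_free_extend)
  have gen: "E (free_gen (x, y, z)) = f x * g y * h z" for x y z
    by (simp add: E_def k.free_extend_gen)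
  have "?L \<in> tensor3_class scale scale scale ?L"
    by (simp add: tensor3_class_def tensor3_null_def F.span_zero)
  then have "?L \<in> tensor3_class scale scale scale ?R"
    unfolding coassoc[of c, unfolded tensor_expand_left_def tensor_expand_right_def] .
  then have "?L - ?R \<in> tensor3_null scale scale scale"
    unfolding tensor3_class_def by (rule CollectD)
  then have "E ?L = E ?R"
    unfolding E_def
    by (rule free_extend_tensor3_eq[OF vector_space_axioms vector_space_axioms vector_space_axioms f g h])
  moreover have "E ?L = conv (conv f g) h c"
  proof -
    have "E (free_extend free_scale (\<lambda>(u, v). free_gen (u, v, z)) (tensor_rep (comult x))) =
        conv f g x * h z" for x z
      unfolding linear_apply_free_extend[OF E] conv_eq[OF f g tensor_rep_comult]
      unfolding free_extend_def case_prod_unfold gen sum_distrib_right mult.assoc by (rule refl)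
    then show ?thesis
      unfolding linear_apply_free_extend[OF E, of _ "tensor_rep (comult c)"]
        conv_eq[OF conv_in_dual[OF f g] h tensor_rep_comult] case_prod_unfold by simp
  qed
  moreover have "E ?R = conv f (conv g h) c"
  proof -
    have "E (free_extend free_scale (\<lambda>(u, v). free_gen (x, u, v)) (tensor_rep (comult z))) =
        f x * conv g h z" for x z
      unfolding linear_apply_free_extend[OF E] conv_eq[OF g h tensor_rep_comult]
      unfolding free_extend_def case_prod_unfold gen sum_distrib_left by (simp only: mult_ac)
    then show ?thesis
      unfolding linear_apply_free_extend[OF E, of _ "tensor_rep (comult c)"]
        conv_eq[OF f conv_in_dual[OF g h] tensor_rep_comult] case_prod_unfold by simp
  qed
  ultimately show ?thesis by simp
qed

lemma counit_in_dual: "counit \<in> dual"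
  using counit_linear by (simp add: dual_def)

text \<open>
  The two sides are computed from the same representative of \<open>comult c\<close>, so that only linearity
  of \<open>f\<close> is at stake.
\<close>

lemma conv_eq_lact: "conv f g c = f (lact g c)" if "f \<in> dual"
proof -
  have lin: "Vector_Spaces.linear scale (*) f" using that by (simp add: dual_def)
  show ?thesis
    unfolding conv_def lact_def tensor_lift_def linear_apply_free_extend[OF lin]
    by (simp add: case_prod_unfold dual_scale[OF that] mult.commute)
qed

lemma conv_eq_ract: "conv f g c = g (ract f c)" if "g \<in> dual"
proof -
  have lin: "Vector_Spaces.linear scale (*) g" using that by (simp add: dual_def)
  show ?thesis
    unfolding conv_def ract_def tensor_lift_def linear_apply_free_extend[OF lin]
    by (simp add: case_prod_unfold dual_scale[OF that])
qed

sublocale dual_actions scale conv counit lact ract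
proof
  fix f assume f: "f \<in> dual"
  show "conv counit f = f"
    using f counit_left by (simp add: fun_eq_iff conv_eq_ract ract_def)
  show "conv f counit = f"
    using f counit_right by (simp add: fun_eq_iff conv_eq_lact lact_def)
qed (auto simp: conv_in_dual counit_in_dual conv_coassoc simp flip: conv_eq_lact conv_eq_ract)

lemma dual_algebra_eq: "dual_algebra scale comult counit = functional_ring"
  unfolding dual_algebra_def functional_ring_def dual_def by (simp add: conv_def[abs_def])

lemma right_comodule_module_eq: "right_comodule_module scale comult = action_module lact"
  by (simp add: right_comodule_module_def action_module_def lact_def[abs_def])

lemma left_comodule_module_eq: "left_comodule_module scale comult = action_module ract"
  by (simp add: left_comodule_module_def action_module_def ract_def[abs_def])

text \<open>
  If \<open>K\<close> is invariant, then the expansion of \<open>comult x\<close> along a basis has the left components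
  \<open>\<delta> b \<rightharpoonup> x\<close>, which lie in \<open>K\<close> for \<open>x \<in> K\<close>.
\<close>

lemma right_subcomodule_iff:
  "right_subcomodule K scale comult \<longleftrightarrow> subspace K \<and> (\<forall>f\<in>dual. \<forall>x\<in>K. lact f x \<in> K)"
proof
  assume K: "right_subcomodule K scale comult"
  show "subspace K \<and> (\<forall>f\<in>dual. \<forall>x\<in>K. lact f x \<in> K)"
  proof (intro conjI ballI)
  show sub: "subspace K" using K by (simp add: right_subcomodule_def)
  fix f x assume f: "f \<in> dual" and "x \<in> K"
  then have "\<exists>t\<in>comult x. \<forall>p\<in>Poly_Mapping.keys t. fst p \<in> K"
    using K by (simp add: right_subcomodule_def)
  then obtain t where t: "t \<in> comult x" "\<forall>p\<in>Poly_Mapping.keys t. fst p \<in> K"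
    by (rule bexE)
  show "lact f x \<in> K"
    unfolding lact_eq[OF f t(1)] free_extend_def case_prod_unfold
    using t(2) sub by (intro subspace_sum subspace_scale) auto
  qed
next
  assume K: "subspace K \<and> (\<forall>f\<in>dual. \<forall>x\<in>K. lact f x \<in> K)"
  have "\<exists>t\<in>comult x. \<forall>p\<in>Poly_Mapping.keys t. fst p \<in> K" if x: "x \<in> K" for x
  proof -
    let ?t = "tensor_rep (comult x)"
    obtain S and \<delta> :: "'c \<Rightarrow> 'c \<Rightarrow> 'k" where \<delta>: "range \<delta> \<subseteq> dual" and
      null: "?t - (\<Sum>b\<in>S. free_gen (free_extend scale (\<lambda>(x, y). scale (\<delta> b y) x) ?t, b)) \<in> tensor_null scale scale"
      by (rule tensor_expansion[OF vector_space_axioms vector_space_axioms, of ?t]) (rule that; assumption)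
    have \<delta>': "\<delta> b \<in> dual" for b using \<delta> by blast
    let ?u = "\<Sum>b\<in>S. free_gen (lact (\<delta> b) x, b) :: _ \<Rightarrow>\<^sub>0 'k"
    have "?t - ?u \<in> tensor_null scale scale"
      using null by (simp add: lact_eq[OF \<delta>' tensor_rep_comult])
    then have "comult x = tensor_class scale scale ?u"
      by (rule trans[OF comult_eq_class[OF tensor_rep_comult] tensor_class_eqI])
    then have "?u \<in> comult x" by (simp add: tensor_class_self)
    moreover have "fst p \<in> K" if "p \<in> Poly_Mapping.keys ?u" for p
    proof -
      have "p \<in> (\<Union>b\<in>S. Poly_Mapping.keys (free_gen (lact (\<delta> b) x, b) :: _ \<Rightarrow>\<^sub>0 'k))"
        by (rule subsetD[OF Poly_Mapping.keys_sum that])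
      then show ?thesis using K x \<delta>' by auto
    qed
    ultimately show ?thesis by blast
  qed
  then show "right_subcomodule K scale comult"
    using K by (simp add: right_subcomodule_def)
qed

text \<open>
  Contracting the second tensor factor with \<open>f\<close> turns colinearity of \<open>h\<close> into
  \<open>f \<rightharpoonup> h c = h (f \<rightharpoonup> c)\<close>. Contractions detect zero, so the comodule endomorphisms are
  precisely the module endomorphisms.
\<close>

lemma right_comodule_endos_eq: "right_comodule_endos scale scale comult = ract ` dual"
proof -
  interpret swap: dual_actions scale "\<lambda>f g. conv g f" counit ract lact by (rule swap)
  \<comment> \<open>a representative of \<open>(h \<otimes> I) (comult c)\<close>\<close>
  define m where "m h c = free_extend free_scale (\<lambda>(x, y). free_gen (h x, y)) (tensor_rep (comult c))"
    for h :: "'c \<Rightarrow> 'c" and c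
  have contract: "free_extend scale (\<lambda>(x, y). scale (f y) x) (m h c) = h (lact f c)"
    if h: "Vector_Spaces.linear scale scale h" and f: "f \<in> dual" for h f c
  proof -
    have "free_extend scale (\<lambda>(x, y). scale (f y) x) (m h c) =
        free_extend scale (\<lambda>(x, y). scale (f y) (h x)) (tensor_rep (comult c))"
      unfolding m_def linear_apply_free_extend[OF linear_free_extend]
      by (simp add: case_prod_unfold free_extend_gen)
    also have "\<dots> = h (lact f c)"
      unfolding lact_eq[OF f tensor_rep_comult] linear_apply_free_extend[OF h]
      using h by (simp add: case_prod_unfold Vector_Spaces.linear_iff)
    finally show ?thesis .
  qed
  have map: "tensor_map scale scale h (\<lambda>c. c) (comult c) = tensor_class scale scale (m h c)" for h c
    by (simp add: tensor_map_def m_def)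
  show ?thesis
  proof (intro equalityI subsetI)
    fix h assume "h \<in> right_comodule_endos scale scale comult"
    then have h: "Vector_Spaces.linear scale scale h"
      and comult_h: "\<And>c. comult (h c) = tensor_class scale scale (m h c)"
      by (auto simp: right_comodule_endos_def map)
    have "lact f (h c) = h (lact f c)" if f: "f \<in> dual" for f c
    proof -
      have "m h c \<in> comult (h c)" by (simp add: comult_h tensor_class_self)
      then show ?thesis by (simp add: lact_eq[OF f] contract[OF h f])
    qed
    then have "h \<in> module_homs functional_ring (action_module lact) (action_module lact)"
      using h by (auto simp: module_homs_def Vector_Spaces.linear_iff)
    then show "h \<in> ract ` dual" by (simp add: module_homs_self)
  next
    fix h assume "h \<in> ract ` dual"
    then obtain u where u: "u \<in> dual" "h = ract u" by blast
    have h: "Vector_Spaces.linear scale scale h"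
      by (simp add: u Vector_Spaces.linear_iff vector_space_axioms swap.lact_add swap.lact_scale)
    have "comult (h c) = tensor_class scale scale (m h c)" for c
    proof -
      have "tensor_rep (comult (h c)) - m h c \<in> tensor_null scale scale"
      proof (rule tensor_null_if_contractions_zero[OF vector_space_axioms vector_space_axioms])
        fix f assume f: "f \<in> dual"
        let ?E = "free_extend scale (\<lambda>(x, y). scale (f y) x)"
        interpret E: Vector_Spaces.linear free_scale scale ?E
          by (rule linear_free_extend)
        have "?E (tensor_rep (comult (h c)) - m h c) = lact f (h c) - h (lact f c)"
          by (simp only: E.diff contract[OF h f] lact_eq[OF f tensor_rep_comult, symmetric])
        also have "\<dots> = 0" using u f by (simp add: lact_ract)
        finally show "?E (tensor_rep (comult (h c)) - m h c) = 0" .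
      qed
      then show ?thesis
        by (rule trans[OF comult_eq_class[OF tensor_rep_comult] tensor_class_eqI])
    qed
    then show "h \<in> right_comodule_endos scale scale comult"
      using h by (simp add: right_comodule_endos_def map)
  qed
qed

lemma endo_coprime_iff:
  "endo_coprime_right_comodule scale scale comult \<longleftrightarrow>
   (\<forall>K. biinvariant K \<and> K \<noteq> UNIV \<longrightarrow> (\<forall>f\<in>dual. range (ract f) \<subseteq> K \<longrightarrow> f = (\<lambda>_. 0)))"
proof -
  interpret swap: dual_actions scale "\<lambda>f g. conv g f" counit ract lact by (rule swap)
  have zero: "ract f = (\<lambda>_. 0) \<longleftrightarrow> f = (\<lambda>_. 0)" if "f \<in> dual" for f
    using swap.lact_faithful[OF that] by (simp add: fun_eq_iff)
  have inv: "right_subcomodule K scale comult \<and> K \<noteq> UNIV \<and> (\<forall>h\<in>ract ` dual. h ` K \<subseteq> K) \<longleftrightarrow>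
      biinvariant K \<and> K \<noteq> UNIV" for K
    unfolding right_subcomodule_iff biinvariant_def by blast
  have "(\<forall>h\<in>ract ` dual. range h \<subseteq> K \<longrightarrow> h = (\<lambda>_. 0)) \<longleftrightarrow>
      (\<forall>f\<in>dual. range (ract f) \<subseteq> K \<longrightarrow> f = (\<lambda>_. 0))" for K
    unfolding ball_simps by (intro ball_cong refl) (simp only: zero)
  then show ?thesis
    unfolding endo_coprime_right_comodule_def right_comodule_endos_eq inv by simp
qed

end


section \<open>Coprime coalgebras\<close>

theorem theorem2p9:
  fixes scale :: "'k::field \<Rightarrow> 'c::ab_group_add \<Rightarrow> 'c"
    and comult :: "'c \<Rightarrow> ('k, 'c, 'c) tensor"
    and counit :: "'c \<Rightarrow> 'k"
  assumes "coalgebra scale comult counit"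
    and "\<exists>c::'c. c \<noteq> 0"
  shows
    "(coprime_right_comodule scale comult counit scale comult \<longleftrightarrow>
      coprime_left_comodule scale comult counit scale comult) \<and>
     (coprime_left_comodule scale comult counit scale comult \<longleftrightarrow>
      endo_coprime_right_comodule scale scale comult) \<and>
     (endo_coprime_right_comodule scale scale comult \<longleftrightarrow>
      fully_coprime_right_comodule scale comult counit scale comult) \<and>
     (fully_coprime_right_comodule scale comult counit scale comult \<longleftrightarrow>
      (\<forall>I. left_ideal I (dual_algebra scale comult counit) \<longrightarrow>
         ideal_smult (right_comodule_module scale comult) I = {0} \<or>
         ideal_smult (right_comodule_module scale comult) I = UNIV)) \<and>
     ((\<forall>I. left_ideal I (dual_algebra scale comult counit) \<longrightarrow>
         ideal_smult (right_comodule_module scale comult) I = {0} \<or>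
         ideal_smult (right_comodule_module scale comult) I = UNIV) \<longleftrightarrow>
      prime_ring (dual_algebra scale comult counit))"
proof -
  interpret coalgebra scale comult counit by fact
  interpret swap: dual_actions scale "\<lambda>f g. conv g f" counit ract lact by (rule swap)
  let ?coprime = "\<forall>K. biinvariant K \<and> K \<noteq> UNIV \<longrightarrow>
    (\<forall>f\<in>dual. range (lact f) \<subseteq> K \<longrightarrow> f = (\<lambda>_. 0))"
  have sides: "?coprime \<longleftrightarrow> (\<forall>K. biinvariant K \<and> K \<noteq> UNIV \<longrightarrow>
      (\<forall>f\<in>dual. range (ract f) \<subseteq> K \<longrightarrow> f = (\<lambda>_. 0)))"
    unfolding lact_coprime_iff_prime ract_coprime_iff_prime by (rule refl)
  have "coprime_right_comodule scale comult counit scale comult \<longleftrightarrow> ?coprime"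
    unfolding coprime_right_comodule_def dual_algebra_eq right_comodule_module_eq
    by (rule coprime_action_module_iff[OF assms(2)])
  moreover have "coprime_left_comodule scale comult counit scale comult \<longleftrightarrow> ?coprime"
    unfolding coprime_left_comodule_def dual_algebra_eq left_comodule_module_eq
      opposite_functional_ring swap.coprime_action_module_iff[OF assms(2)] biinvariant_swap
    by (rule sides[symmetric])
  moreover have "endo_coprime_right_comodule scale scale comult \<longleftrightarrow> ?coprime"
    unfolding endo_coprime_iff by (rule sides[symmetric])
  moreover have "fully_coprime_right_comodule scale comult counit scale comult \<longleftrightarrow> ?coprime"
    unfolding fully_coprime_right_comodule_def dual_algebra_eq right_comodule_module_eq
    by (rule fully_coprime_action_module_iff[OF assms(2)])
  moreover have "(\<forall>I. left_ideal I (dual_algebra scale comult counit) \<longrightarrow>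
      ideal_smult (right_comodule_module scale comult) I = {0} \<or>
      ideal_smult (right_comodule_module scale comult) I = UNIV) \<longleftrightarrow> ?coprime"
    unfolding dual_algebra_eq right_comodule_module_eq
    by (rule lact_coprime_iff_left_ideals[symmetric])
  moreover have "prime_ring (dual_algebra scale comult counit) \<longleftrightarrow> ?coprime"
    unfolding dual_algebra_eq prime_functional_ring_iff[OF assms(2)]
    by (rule lact_coprime_iff_prime[symmetric])
  ultimately show ?thesis by (simp only: simp_thms)
qed

end
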